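(* In the setting described in the context (problem $\min F=f+r$, assumptions (B1)–(B6), $\lambda>0$ with $\lambda(\tau+\rho)<1$, iteration count $T$), assume $F$ attains its minimum. For some $\alpha>0$, set $\eta_t=\frac{1}{M+\lambda^{-1}+\alpha^{-1}\sqrt{T+1}}$ for all indices $t=0,\ldots, T$. Then the random point $x_{t^*}$ returned by the stochastic mirror descent algorithm satisfies $$\mathbb{E}\left[ D_{\Phi}\left(\mathrm{prox}_{\lambda F}^\Phi (x_{t^*}),x_{t^*}\right) \right] \le \frac{\lambda^2(F^\Phi_\lambda(x_0) - \min F)+\lambda\left(\frac{\sigma\alpha}{2}\right)^2}{1-(\tau+\rho)\lambda}\cdot\left(\frac{M+\lambda^{-1}-\rho}{T+1}+\frac{1}{\alpha\sqrt{T+1}}\right).$$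
   Context: Legendre functions. $\Phi\colon\mathbb{R}^d\to\mathbb{R}\cup\{\infty\}$ is a Legendre function: it is proper, closed, strictly convex; $U:=\mathrm{int}(\mathrm{dom}\,\Phi)$ is nonempty; $\Phi$ is differentiable on $U$; and $\|\nabla\Phi(x_k)\|\to\infty$ for any sequence $\{x_k\}\subset U$ converging to a boundary point of $\mathrm{dom}\,\Phi$. Its Bregman divergence is $D_\Phi(y,x)=\Phi(y)-\Phi(x)-\langle\nabla\Phi(x),y-x\rangle$ for $x\in U$, $y\in\mathrm{dom}\,\Phi$. A function $g$ is $\rho$-weakly convex relative to $\Phi$ if $g+\rho\Phi$ is convex. Problem. $\min_x F(x):=f(x)+r(x)$, where $f\colon\mathbb{R}^d\to\mathbb{R}$ is locally Lipschitz (and differentiable at the points where $\nabla f$ appears below), $r\colon\mathbb{R}^d\to\mathbb{R}\cup\{\infty\}$ is closed with convex domain, and $\mathrm{ri}(\mathrm{dom}\,r)\subseteq U$ and $\partial(r+\Phi)(x)=\emptyset$ for all $x\notin U$. Here $\partial$ is the limiting subdifferential: $v\in\partial g(x)$ iff there are $x_k\to x$ with $g(x_k)\to g(x)$ and $v_k\to v$ with $v_k\in\hat\partial g(x_k)$, where $\hat\partial g(x)=\{v: g(y)\ge g(x)+\langle v,y-x\rangle+o(\|y-x\|)\text{ as }y\to x\}$. Assumptions. $(\Omega,\mathcal{F},P)$ is a probability space. (B1) i.i.d. samples $\xi_0,\xi_1,\ldots\sim P$ can be generated. (B2) There is a measurable mapping $G\colon U\times\Omega\to\mathbb{R}^d$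 with $\mathbb{E}_\xi[G(x,\xi)]=\nabla f(x)$ for all $x\in U\cap\mathrm{dom}\,r$. (B3) There are reals $\tau,M\ge0$ with $-\tau D_\Phi(y,x)\le f(y)-f(x)-\langle\nabla f(x),y-x\rangle\le M D_\Phi(y,x)$ for all $x,y\in U\cap\mathrm{dom}\,r$. (B4) $r$ is $\rho$-weakly convex relative to $\Phi$, with $\rho\ge0$. (B5) $\Phi$ is $1$-strongly convex with respect to some norm $\|\cdot\|$, so that $D_\Phi(y,x)\ge\frac12\|y-x\|^2$; $\|\cdot\|_*$ denotes the dual norm. (B6) $\mathbb{E}_\xi[\|G(x,\xi)-\nabla f(x)\|_*^2]\le\frac{\sigma^2}{2}<\infty$ for all $x\in U\cap\mathrm{dom}\,r$. Envelope and proximal map. $F_\lambda^\Phi(x):=\inf_y\{F(y)+\frac1\lambda D_\Phi(y,x)\}$ and $\mathrm{prox}_{\lambda F}^\Phi(x):=\mathrm{argmin}_y\{F(y)+\frac1\lambda D_\Phi(y,x)\}$. Algorithm (stochastic mirror descent). Input: $x_0\in U\cap\mathrm{dom}\,r$, $\lambda>0$ with $\lambda<(\tau+\rho)^{-1}$, step-sizes $\eta_t\in(0,\frac{\lambda}{1+\lambda M})$, iteration count $T$. For $t=0,\ldots,T$: sample $\xi_t\sim P$ (independently) and set $x_{t+1}=\mathrm{argmin}_x\{\langle G(x_t,\xi_t),x\rangle+r(x)+\frac1{\eta_t}D_\Phi(x,x_t)\}$. Then sample $t^*\in\{0,\ldots,T\}$, independently of the $\xi_t$, with $\mathbb{P}(t^*=t)\propto\frac{\eta_t}{1-\eta_t\rho}$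 and return $x_{t^*}$. The expectation is over all randomness. *)

theory Defs
  imports "HOL-Probability.Probability"
begin

text \<open>
  Functions with values in \<open>\<real> \<union> {\<infinity>}\<close> are modelled as \<open>ereal\<close>-valued functions that never take
  the value \<open>-\<infinity>\<close>; the latter is always required explicitly. The space \<open>\<real>\<^sup>d\<close> is an arbitrary
  type of class \<open>euclidean_space\<close>.
\<close>

definition eff_dom :: "('a \<Rightarrow> ereal) \<Rightarrow> 'a set" where
  "eff_dom g = {x. g x < \<infinity>}"

definition closed_fun :: "('a::topological_space \<Rightarrow> ereal) \<Rightarrow> bool" where
  "closed_fun g \<longleftrightarrow> closed {(x, s::real). g x \<le> ereal s}"

definition convex_fun :: "('a::real_vector \<Rightarrow> ereal) \<Rightarrow> bool" where
  "convex_fun g \<longleftrightarrow>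
     (\<forall>x y. \<forall>u\<ge>0. \<forall>v\<ge>0. u + v = 1 \<longrightarrow>
        g (u *\<^sub>R x + v *\<^sub>R y) \<le> ereal u * g x + ereal v * g y)"

definition strictly_convex_fun :: "('a::real_vector \<Rightarrow> ereal) \<Rightarrow> bool" where
  "strictly_convex_fun g \<longleftrightarrow>
     convex_fun g \<and>
     (\<forall>x\<in>eff_dom g. \<forall>y\<in>eff_dom g. \<forall>u>0. \<forall>v>0. x \<noteq> y \<and> u + v = 1 \<longrightarrow>
        g (u *\<^sub>R x + v *\<^sub>R y) < ereal u * g x + ereal v * g y)"

definition is_norm :: "('a::real_vector \<Rightarrow> real) \<Rightarrow> bool" where
  "is_norm N \<longleftrightarrow>
     (\<forall>x. N x = 0 \<longleftrightarrow> x = 0) \<and>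
     (\<forall>c x. N (c *\<^sub>R x) = \<bar>c\<bar> * N x) \<and>
     (\<forall>x y. N (x + y) \<le> N x + N y)"

definition dual_norm :: "('a::real_inner \<Rightarrow> real) \<Rightarrow> 'a \<Rightarrow> real" where
  "dual_norm N v = (SUP x\<in>{x. N x \<le> 1}. v \<bullet> x)"

definition strongly_convex_fun :: "real \<Rightarrow> ('a::real_vector \<Rightarrow> real) \<Rightarrow> ('a \<Rightarrow> ereal) \<Rightarrow> bool" where
  "strongly_convex_fun m N g \<longleftrightarrow>
     (\<forall>x y. \<forall>u\<ge>0. \<forall>v\<ge>0. u + v = 1 \<longrightarrow>
        g (u *\<^sub>R x + v *\<^sub>R y) + ereal (m / 2 * u * v * (N (x - y))\<^sup>2)
          \<le> ereal u * g x + ereal v * g y)"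

definition weakly_convex_rel :: "real \<Rightarrow> ('a::real_vector \<Rightarrow> ereal) \<Rightarrow> ('a \<Rightarrow> ereal) \<Rightarrow> bool" where
  "weakly_convex_rel \<rho> \<Phi> g \<longleftrightarrow> convex_fun (\<lambda>x. g x + ereal \<rho> * \<Phi> x)"

definition locally_lipschitz :: "('a::metric_space \<Rightarrow> 'b::metric_space) \<Rightarrow> bool" where
  "locally_lipschitz f \<longleftrightarrow> (\<forall>x. \<exists>u>0. \<exists>L. L-lipschitz_on (cball x u) f)"

definition grad :: "('a::real_inner \<Rightarrow> real) \<Rightarrow> 'a \<Rightarrow> 'a" where
  "grad g x = (THE D. GDERIV g x :> D)"

abbreviation egrad :: "('a::real_inner \<Rightarrow> ereal) \<Rightarrow> 'a \<Rightarrow> 'a" where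
  "egrad g \<equiv> grad (\<lambda>y. real_of_ereal (g y))"

text \<open>
  Following the usual convention, both subdifferentials are empty at points where the function
  is not finite.
\<close>

definition frechet_subdiff :: "('a::real_inner \<Rightarrow> ereal) \<Rightarrow> 'a \<Rightarrow> 'a set" where
  "frechet_subdiff g x =
     {v. \<bar>g x\<bar> \<noteq> \<infinity> \<and>
         (\<forall>\<epsilon>>0. \<forall>\<^sub>F y in nhds x. g x + ereal (v \<bullet> (y - x) - \<epsilon> * norm (y - x)) \<le> g y)}"

definition limiting_subdiff :: "('a::real_inner \<Rightarrow> ereal) \<Rightarrow> 'a \<Rightarrow> 'a set" where
  "limiting_subdiff g x =
     {v. \<bar>g x\<bar> \<noteq> \<infinity> \<and>
         (\<exists>xs vs. xs \<longlonglongrightarrow> x \<and> (\<lambda>k. g (xs k)) \<longlonglongrightarrow> g x \<and> vs \<longlonglongrightarrow> v \<and>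
            (\<forall>k. vs k \<in> frechet_subdiff g (xs k)))}"

definition legendre :: "('a::euclidean_space \<Rightarrow> ereal) \<Rightarrow> bool" where
  "legendre \<Phi> \<longleftrightarrow>
     (\<forall>x. \<Phi> x \<noteq> -\<infinity>) \<and> eff_dom \<Phi> \<noteq> {} \<and>
     closed_fun \<Phi> \<and> strictly_convex_fun \<Phi> \<and>
     interior (eff_dom \<Phi>) \<noteq> {} \<and>
     (\<forall>x\<in>interior (eff_dom \<Phi>). (\<lambda>y. real_of_ereal (\<Phi> y)) differentiable (at x)) \<and>
     (\<forall>xs. \<forall>x\<in>frontier (eff_dom \<Phi>).
        (\<forall>k. xs k \<in> interior (eff_dom \<Phi>)) \<and> xs \<longlonglongrightarrow> x \<longrightarrow>
        filterlim (\<lambda>k. norm (egrad \<Phi> (xs k))) at_top sequentially)"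

text \<open>
  The divergence is meaningful for \<open>x\<close> in the interior of the domain of \<open>\<Phi>\<close>; for such \<open>x\<close>
  it equals \<open>\<infinity>\<close> when \<open>y\<close> lies outside the domain, so the minimisations below may range over
  all \<open>y\<close>.
\<close>

definition bregman :: "('a::real_inner \<Rightarrow> ereal) \<Rightarrow> 'a \<Rightarrow> 'a \<Rightarrow> ereal" where
  "bregman \<Phi> y x = \<Phi> y - \<Phi> x - ereal (egrad \<Phi> x \<bullet> (y - x))"

definition envelope :: "('a::real_inner \<Rightarrow> ereal) \<Rightarrow> real \<Rightarrow> ('a \<Rightarrow> ereal) \<Rightarrow> 'a \<Rightarrow> ereal" where
  "envelope \<Phi> lam F x = (INF y. F y + ereal (1 / lam) * bregman \<Phi> y x)"

definition prox :: "('a::real_inner \<Rightarrow> ereal) \<Rightarrow> real \<Rightarrow> ('a \<Rightarrow> ereal) \<Rightarrow> 'a \<Rightarrow> 'a" where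
  "prox \<Phi> lam F x = arg_min (\<lambda>y. F y + ereal (1 / lam) * bregman \<Phi> y x) (\<lambda>y. True)"

definition objective :: "('a \<Rightarrow> real) \<Rightarrow> ('a \<Rightarrow> ereal) \<Rightarrow> 'a \<Rightarrow> ereal" where
  "objective f r x = ereal (f x) + r x"

text \<open>Stochastic mirror descent, run on a fixed realisation \<open>s\<close> of the samples.\<close>

primrec smd ::
  "('a::real_inner \<Rightarrow> ereal) \<Rightarrow> ('a \<Rightarrow> ereal) \<Rightarrow> ('a \<Rightarrow> 'w \<Rightarrow> 'a) \<Rightarrow> (nat \<Rightarrow> real) \<Rightarrow> 'a \<Rightarrow>
   (nat \<Rightarrow> 'w) \<Rightarrow> nat \<Rightarrow> 'a" where
  "smd \<Phi> r G \<eta> x0 s 0 = x0"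
| "smd \<Phi> r G \<eta> x0 s (Suc t) =
     (let x = smd \<Phi> r G \<eta> x0 s t in
      arg_min (\<lambda>y. ereal (G x (s t) \<bullet> y) + r y + ereal (1 / \<eta> t) * bregman \<Phi> y x) (\<lambda>y. True))"

end

theory Submission
  imports Defs
begin

text \<open>
  The Bregman--Moreau envelope of the objective is a Lyapunov function for stochastic mirror
  descent. Let \<open>x\<close> be an iterate, \<open>p\<close> the next one, \<open>h\<close> the proximal point of \<open>x\<close>, and \<open>c\<close> the
  inverse step size. The function minimised in a step is \<open>c - \<rho>\<close> strongly convex relative to the
  mirror map, so its value at \<open>h\<close> exceeds its minimum by at least \<open>c - \<rho>\<close> times the divergence
  \<open>D h p\<close> of \<open>h\<close> from \<open>p\<close>. Replacing the gradient by the two-sided model of \<open>f\<close>, and comparing \<open>h\<close> with \<open>p\<close> as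
  competitors in the proximal problem of \<open>x\<close>, gives (\<open>one_step\<close>)

    \<open>(c - \<rho>) D h p \<le> (c + \<tau> - 1 / lam) D h x + e \<bullet> (h - x) + \<parallel>e\<parallel>\<^sup>2 / (2 \<beta>)\<close>

  for the gradient noise \<open>e\<close> and its dual norm, where \<open>c = M + 1 / lam + \<beta>\<close>: the part \<open>M + 1 / lam\<close>
  pays for the two comparisons, and the surplus \<open>\<beta>\<close> for the product of the noise and the step. In
  expectation the linear noise term vanishes. Since \<open>h\<close> is a competitor in the proximal problem of
  \<open>p\<close>, the expected envelope decreases by a multiple of \<open>D h x\<close>, up to a variance term
  (\<open>expected_env_step\<close>). Summing over the iterations (\<open>driven_telescoping\<close>) bounds the total of these
  divergences; with constant step sizes the returned index is uniformly distributed, so the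
  expectation to be bounded is this total divided by \<open>T + 1\<close>.

  Two points need care. First, the argument uses gradients of the mirror map at the minimisers, so
  the minimisers must exist and avoid the boundary of its domain. They avoid it
  because a Legendre function descends from a boundary point towards the interior with infinite
  slope (\<open>no_finite_slope_at_boundary\<close>), while the rest of the objective rises at most linearly there. Second, the
  iterates and proximal points must be measurable. Each step and each proximal point
  minimises a fixed function minus a
  linear one, and strong convexity makes such a minimiser a Lipschitz function of the linear part
  (\<open>tilted_argmin_continuous\<close>).
\<close>


section \<open>Lower semicontinuity and the existence of minimisers\<close>

text \<open>Levels range over all extended reals, which makes Borel measurability immediate.\<close>

definition lsc :: "('a::topological_space \<Rightarrow> ereal) \<Rightarrow> bool" where
  "lsc g \<longleftrightarrow> (\<forall>l. open {x. l < g x})"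

lemma lscD: "lsc g \<Longrightarrow> open {x. l < g x}"
  by (simp add: lsc_def)

lemma lsc_realI:
  assumes "\<And>a::real. open {x. ereal a < g x}"
  shows "lsc g"
  unfolding lsc_def
proof
  fix l :: ereal
  have "{x. -\<infinity> < g x} = (\<Union>a::real. {x. ereal a < g x})"
    using ereal_dense2[of "-\<infinity>"] less_ereal.simps(5) order_less_trans by (auto; blast)
  then show "open {x. l < g x}"
    using assms by (cases l) auto
qed

lemma closed_fun_imp_lsc:
  fixes g :: "'a::topological_space \<Rightarrow> ereal"
  assumes "closed_fun g"
  shows "lsc g"
proof (rule lsc_realI)
  fix a :: real
  have "continuous_on UNIV (\<lambda>x::'a. (x, a))"
    by (intro continuous_intros)
  with assms have "closed ((\<lambda>x. (x, a)) -` {(x, s::real). g x \<le> ereal s})"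
    unfolding closed_fun_def by (rule closed_vimage)
  then have "open (- {x. g x \<le> ereal a})"
    by (simp add: vimage_def open_Compl)
  also have "- {x. g x \<le> ereal a} = {x. ereal a < g x}"
    by auto
  finally show "open {x. ereal a < g x}" .
qed

lemma lsc_continuous:
  assumes "continuous_on UNIV f"
  shows "lsc (\<lambda>x. ereal (f x))"
proof (rule lsc_realI)
  fix a :: real
  show "open {x. ereal a < ereal (f x)}"
    using assms by (simp add: open_Collect_less)
qed

lemma lsc_add:
  assumes g: "lsc g" and h: "lsc h"
    and ninf: "\<And>x. g x \<noteq> -\<infinity>" "\<And>x. h x \<noteq> -\<infinity>"
  shows "lsc (\<lambda>x. g x + h x)"
proof (rule lsc_realI)
  fix a :: real
  have "\<exists>b::real. ereal b < g x \<and> ereal (a - b) < h x" if "ereal a < g x + h x" for x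
  proof (cases "h x")
    case (real s)
    with that have "ereal (a - s) < g x"
      by (cases "g x") auto
    then obtain b where "ereal (a - s) < ereal b" "ereal b < g x"
      using ereal_dense2 by blast
    with real show ?thesis
      by (intro exI[of _ b]) auto
  next
    case PInf
    then show ?thesis
      using ninf(1)[of x] by (cases "g x") (auto intro: lt_ex)
  qed (use ninf in auto)
  moreover have "ereal a < g x + h x" if "ereal b < g x" "ereal (a - b) < h x" for x b
    using that by (cases "g x"; cases "h x") auto
  ultimately have "{x. ereal a < g x + h x} =
      (\<Union>b::real. {x. ereal b < g x} \<inter> {x. ereal (a - b) < h x})"
    by auto
  then show "open {x. ereal a < g x + h x}"
    using lscD[OF g] lscD[OF h] by (auto intro!: open_UN open_Int)
qed

lemma lsc_cmult:
  assumes "lsc g" and "c > 0"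
  shows "lsc (\<lambda>x. ereal c * g x)"
proof (rule lsc_realI)
  fix a :: real
  have "ereal a < ereal c * g x \<longleftrightarrow> ereal (a / c) < g x" for x
    using \<open>c > 0\<close> by (cases "g x") (auto simp: field_simps)
  then show "open {x. ereal a < ereal c * g x}"
    using lscD[OF assms(1)] by simp
qed

lemma lsc_borel_measurable:
  assumes "lsc g"
  shows "g \<in> borel_measurable borel"
  using lscD[OF assms] by (intro borel_measurableI_greater) auto

text \<open>
  If no point of the compact set were a minimiser, the open sets on which the function exceeds one
  of its values would cover the set; the smallest value belonging to a finite subcover would then
  exceed one of the others.
\<close>

lemma lsc_attains_min_on_compact:
  assumes "lsc h" and "compact K" and "K \<noteq> {}"
  shows "\<exists>p\<in>K. \<forall>y\<in>K. h p \<le> h y"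
proof (rule ccontr)
  assume "\<not> ?thesis"
  then have "K \<subseteq> (\<Union>y\<in>K. {x. h y < h x})"
    by (auto simp: not_le)
  then obtain I where I: "I \<subseteq> K" "finite I" "K \<subseteq> (\<Union>y\<in>I. {x. h y < h x})"
    using compactE_image[OF assms(2), of K "\<lambda>y. {x. h y < h x}"] lscD[OF assms(1)] by metis
  with assms(3) have "I \<noteq> {}"
    by auto
  then obtain p where p: "p \<in> I" "\<forall>y\<in>I. h p \<le> h y"
    using I(2) ex_min_if_finite[of "h ` I"] by (auto simp: not_less)
  with I show False
    by (auto simp: subset_iff not_less) (meson leD)
qed

text \<open>
  Outside a large ball the quadratic term lifts the function above its value at \<open>z\<close>, so only a
  compact set has to be searched.
\<close>

lemma lsc_coercive_attains_min:
  fixes h :: "'a::euclidean_space \<Rightarrow> ereal"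
  assumes h: "lsc h" and k: "k > 0" and z: "h z < \<infinity>"
    and lower: "\<And>y. ereal (A + w \<bullet> (y - z) + k * (norm (y - z))\<^sup>2) \<le> h y"
  shows "\<exists>p. \<forall>y. h p \<le> h y"
proof -
  obtain a where a: "h z = ereal a"
    using z lower[of z] by (cases "h z") auto
  define R where "R = 1 + (norm w + \<bar>a - A\<bar>) / k"
  have R: "R \<ge> 1"
    using k by (simp add: R_def)
  have far: "h z < h y" if "norm (y - z) > R" for y
  proof -
    define n where "n = norm (y - z)"
    have "k * n - norm w > k + \<bar>a - A\<bar>"
      using that k by (simp add: n_def R_def field_simps)
    moreover have "n \<ge> 1"
      using that R by (simp add: n_def)
    ultimately have "n * (k * n - norm w) > \<bar>a - A\<bar>"
      using k by (smt (verit, best) mult_le_cancel_right1 zero_le_mult_iff)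
    moreover have "w \<bullet> (y - z) \<ge> - (norm w * n)"
      using Cauchy_Schwarz_ineq2[of w "y - z"] by (simp add: n_def)
    ultimately have "a < A + w \<bullet> (y - z) + k * (norm (y - z))\<^sup>2"
      by (simp add: n_def[symmetric] power2_eq_square algebra_simps)
    then show ?thesis
      using lower[of y] a by (metis less_ereal.simps(1) order_less_le_trans)
  qed
  obtain p where p: "p \<in> cball z R" "\<forall>y\<in>cball z R. h p \<le> h y"
    using lsc_attains_min_on_compact[OF h compact_cball, of z R] R by auto
  have "h p \<le> h y" for y
  proof (cases "y \<in> cball z R")
    case False
    then have "h z < h y"
      by (intro far) (simp add: dist_norm norm_minus_commute)
    moreover have "h p \<le> h z"
      using p R by simp
    ultimately show ?thesis
      by simp
  qed (use p in blast)
  then show ?thesis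
    by blast
qed


section \<open>Norms on Euclidean space and their duals\<close>

lemma is_norm_nonneg:
  assumes "is_norm N"
  shows "N x \<ge> 0"
proof -
  have "N (x + (-1) *\<^sub>R x) \<le> N x + N ((-1) *\<^sub>R x)" "N ((-1) *\<^sub>R x) = \<bar>-1\<bar> * N x" "N 0 = 0"
    using assms unfolding is_norm_def by blast+
  then show ?thesis
    by simp
qed

lemma is_norm_zero: "is_norm N \<Longrightarrow> N 0 = 0"
  unfolding is_norm_def by blast

lemma is_norm_minus_commute:
  assumes "is_norm N"
  shows "N (x - y) = N (y - x)"
proof -
  have "N ((-1) *\<^sub>R (y - x)) = \<bar>-1\<bar> * N (y - x)"
    using assms unfolding is_norm_def by blast
  then show ?thesis
    by simp
qed

lemma is_norm_le_norm:
  fixes N :: "'a::euclidean_space \<Rightarrow> real"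
  assumes N: "is_norm N"
  shows "N x \<le> norm x * (\<Sum>b\<in>Basis. N b)"
proof -
  have sum_le: "N (\<Sum>b\<in>A. g b) \<le> (\<Sum>b\<in>A. N (g b))" if "finite A" for A and g :: "'a \<Rightarrow> 'a"
    using that
  proof (induction A)
    case empty
    then show ?case using N by (simp add: is_norm_zero)
  next
    case (insert a A)
    have "N (g a + (\<Sum>b\<in>A. g b)) \<le> N (g a) + N (\<Sum>b\<in>A. g b)"
      using N by (simp add: is_norm_def)
    with insert show ?case by simp
  qed
  have "N x = N (\<Sum>b\<in>Basis. (x \<bullet> b) *\<^sub>R b)"
    by (simp add: euclidean_representation)
  also have "\<dots> \<le> (\<Sum>b\<in>Basis. N ((x \<bullet> b) *\<^sub>R b))"
    by (rule sum_le) simp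
  also have "\<dots> = (\<Sum>b\<in>Basis. \<bar>x \<bullet> b\<bar> * N b)"
    using N by (simp add: is_norm_def)
  also have "\<dots> \<le> (\<Sum>b\<in>Basis. norm x * N b)"
    by (intro sum_mono mult_right_mono Basis_le_norm is_norm_nonneg[OF N])
  finally show ?thesis
    by (simp add: sum_distrib_left)
qed

lemma is_norm_continuous:
  fixes N :: "'a::euclidean_space \<Rightarrow> real"
  assumes N: "is_norm N"
  shows "continuous_on UNIV N"
proof -
  define L where "L = (\<Sum>b\<in>Basis. N b)"
  have half: "N x - N y \<le> L * norm (x - y)" for x y
  proof -
    have "N (y + (x - y)) \<le> N y + N (x - y)"
      using N unfolding is_norm_def by blast
    with is_norm_le_norm[OF N, of "x - y"] show ?thesis
      by (simp add: L_def mult.commute)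
  qed
  have "L-lipschitz_on UNIV N"
  proof (rule lipschitz_onI)
    show "L \<ge> 0"
      by (simp add: L_def sum_nonneg is_norm_nonneg[OF N])
    show "dist (N x) (N y) \<le> L * dist x y" for x y
      using half[of x y] half[of y x] by (simp add: dist_norm norm_minus_commute abs_le_iff)
  qed
  then show ?thesis
    by (rule lipschitz_on_continuous_on)
qed

text \<open>Compactness of the unit sphere makes the infimum of the norm there positive.\<close>

lemma is_norm_ge_norm:
  fixes N :: "'a::euclidean_space \<Rightarrow> real"
  assumes N: "is_norm N"
  obtains k where "k > 0" "\<And>x. k * norm x \<le> N x"
proof -
  have "compact (sphere (0::'a) 1)" "sphere (0::'a) 1 \<noteq> {}"
    by auto
  then obtain z where z: "z \<in> sphere 0 1" "\<And>y. y \<in> sphere 0 1 \<Longrightarrow> N z \<le> N y"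
    using continuous_attains_inf[of "sphere 0 1" N]
      continuous_on_subset[OF is_norm_continuous[OF N]] by blast
  show thesis
  proof
    have "z \<noteq> 0" using z by auto
    then show "N z > 0"
      using N is_norm_nonneg[OF N, of z] by (simp add: is_norm_def less_le)
    show "N z * norm x \<le> N x" for x
    proof (cases "x = 0")
      case False
      have "N z \<le> N ((1 / norm x) *\<^sub>R x)"
        using False by (intro z(2)) simp
      also have "\<dots> = (1 / norm x) * N x"
        using N by (simp add: is_norm_def)
      finally show ?thesis
        using False by (simp add: field_simps)
    qed (use is_norm_nonneg[OF N] in auto)
  qed
qed

lemma dual_norm_bdd:
  fixes N :: "'a::euclidean_space \<Rightarrow> real"
  assumes N: "is_norm N"
  obtains K where "K > 0" "\<And>x v. N x \<le> 1 \<Longrightarrow> v \<bullet> x \<le> norm v * K"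
proof -
  obtain k where k: "k > 0" "\<And>x. k * norm x \<le> N x"
    using is_norm_ge_norm[OF N] by blast
  show thesis
  proof
    show "1 / k > 0" using k by simp
    fix x v :: 'a assume "N x \<le> 1"
    then have "norm x \<le> 1 / k"
      using k(1) k(2)[of x] by (simp add: field_simps)
    then have "norm v * norm x \<le> norm v * (1 / k)"
      by (intro mult_left_mono) auto
    with norm_cauchy_schwarz[of v x] show "v \<bullet> x \<le> norm v * (1 / k)"
      by linarith
  qed
qed

lemma inner_le_dual_norm:
  fixes N :: "'a::euclidean_space \<Rightarrow> real"
  assumes N: "is_norm N"
  shows "v \<bullet> x \<le> dual_norm N v * N x"
proof (cases "x = 0")
  case False
  then have pos: "N x > 0"
    using N is_norm_nonneg[OF N, of x] by (simp add: is_norm_def less_le)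
  obtain K where K: "\<And>x v. N x \<le> 1 \<Longrightarrow> v \<bullet> x \<le> norm v * K"
    using dual_norm_bdd[OF N] by metis
  have bdd: "bdd_above ((\<bullet>) v ` {x. N x \<le> 1})"
    using K by (intro bdd_aboveI2) auto
  have "N ((1 / N x) *\<^sub>R x) = \<bar>1 / N x\<bar> * N x"
    using N unfolding is_norm_def by blast
  then have "(1 / N x) *\<^sub>R x \<in> {x. N x \<le> 1}"
    using pos by simp
  from cSUP_upper[OF this bdd] have "v \<bullet> ((1 / N x) *\<^sub>R x) \<le> dual_norm N v"
    by (simp add: dual_norm_def)
  then show ?thesis
    using pos by (simp add: field_simps)
next
  case True
  then show ?thesis
    using N by (simp add: is_norm_zero)
qed

lemma dual_norm_continuous:
  fixes N :: "'a::euclidean_space \<Rightarrow> real"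
  assumes N: "is_norm N"
  shows "continuous_on UNIV (dual_norm N)"
proof -
  obtain K where K: "K > 0" "\<And>x v. N x \<le> 1 \<Longrightarrow> v \<bullet> x \<le> norm v * K"
    using dual_norm_bdd[OF N] by metis
  have bdd: "bdd_above ((\<bullet>) v ` {x. N x \<le> 1})" for v
    using K by (intro bdd_aboveI2) auto
  have ne: "0 \<in> {x. N x \<le> 1}"
    using N by (simp add: is_norm_zero)
  have half: "dual_norm N v \<le> dual_norm N w + K * norm (v - w)" for v w
    unfolding dual_norm_def[of N v]
  proof (rule cSUP_least)
    fix x assume x: "x \<in> {x. N x \<le> 1}"
    then have "w \<bullet> x \<le> dual_norm N w"
      unfolding dual_norm_def by (intro cSUP_upper bdd)
    moreover have "(v - w) \<bullet> x \<le> norm (v - w) * K"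
      using K x by blast
    ultimately show "v \<bullet> x \<le> dual_norm N w + K * norm (v - w)"
      by (simp add: inner_diff_left mult.commute)
  qed (use ne in blast)
  have "K-lipschitz_on UNIV (dual_norm N)"
  proof (rule lipschitz_onI)
    show "dist (dual_norm N v) (dual_norm N w) \<le> K * dist v w" for v w
      using half[of v w] half[of w v] by (simp add: dist_norm norm_minus_commute abs_le_iff)
  qed (use K in simp)
  then show ?thesis
    by (rule lipschitz_on_continuous_on)
qed


section \<open>Gradients of convex functions\<close>

lemma differentiable_imp_GDERIV_grad:
  fixes g :: "'a::euclidean_space \<Rightarrow> real"
  assumes "g differentiable (at x)"
  shows "GDERIV g x :> grad g x"
proof -
  obtain g' where g': "(g has_derivative g') (at x)"
    using assms by (auto simp: differentiable_def)
  then interpret bounded_linear g'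
    by (rule has_derivative_bounded_linear)
  have "g' = (\<lambda>h. h \<bullet> (\<Sum>b\<in>Basis. g' b *\<^sub>R b))"
  proof (rule ext)
    fix h
    have "g' h = g' (\<Sum>b\<in>Basis. (h \<bullet> b) *\<^sub>R b)"
      by (simp add: euclidean_representation)
    also have "\<dots> = h \<bullet> (\<Sum>b\<in>Basis. g' b *\<^sub>R b)"
      by (simp add: sum scaleR inner_sum_right mult.commute)
    finally show "g' h = h \<bullet> (\<Sum>b\<in>Basis. g' b *\<^sub>R b)" .
  qed
  then have ex: "GDERIV g x :> (\<Sum>b\<in>Basis. g' b *\<^sub>R b)"
    using g' unfolding gderiv_def by (simp only:)
  have uniq: "D = E" if "GDERIV g x :> D" "GDERIV g x :> E" for D E
  proof -
    have "(\<lambda>h. h \<bullet> D) = (\<lambda>h. h \<bullet> E)"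
      using that unfolding gderiv_def by (rule has_derivative_unique)
    then have "\<forall>h. h \<bullet> D = h \<bullet> E"
      by (simp add: fun_eq_iff)
    then show ?thesis
      by (rule iffD1[OF vector_eq_ldot])
  qed
  show ?thesis
    unfolding grad_def by (rule theI') (use ex uniq in blast)
qed

lemma GDERIV_directional:
  assumes "GDERIV g x :> D"
  shows "((\<lambda>t. (g (x + t *\<^sub>R d) - g x) / t) \<longlongrightarrow> D \<bullet> d) (at_right 0)"
proof -
  have "((\<lambda>t. g (x + t *\<^sub>R d)) has_derivative (\<lambda>t. (t *\<^sub>R d) \<bullet> D)) (at 0)"
    using assms unfolding gderiv_def
    by (intro has_derivative_compose[of "\<lambda>t. x + t *\<^sub>R d" "\<lambda>t. t *\<^sub>R d" 0 UNIV g])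
      (auto intro!: derivative_eq_intros)
  moreover have "(\<lambda>t. (t *\<^sub>R d) \<bullet> D) = (*) (D \<bullet> d)"
    by (rule ext) (simp add: inner_commute)
  ultimately have "((\<lambda>t. g (x + t *\<^sub>R d)) has_real_derivative (D \<bullet> d)) (at 0)"
    by (simp add: has_field_derivative_def)
  then have "((\<lambda>t. (g (x + t *\<^sub>R d) - g x) / t) \<longlongrightarrow> D \<bullet> d) (at 0)"
    by (simp add: has_field_derivative_iff)
  then show ?thesis
    by (rule filterlim_mono) (simp_all add: at_le)
qed

lemma eventually_at_right_0_1: "\<forall>\<^sub>F t in at_right (0::real). 0 < t \<and> t < 1"
  using eventually_at_right_real[of 0 1] by (auto elim: eventually_mono)

text \<open>
  The chord inequality bounds the difference quotients at \<open>x\<close> in the direction of \<open>y\<close>; the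
  claim is its limit. The constant \<open>K\<close> carries a strong convexity term.
\<close>

lemma gradient_inequality:
  assumes D: "GDERIV g x :> D"
    and chord: "\<And>t. 0 < t \<Longrightarrow> t < 1 \<Longrightarrow>
      g (x + t *\<^sub>R (y - x)) + K * t * (1 - t) \<le> (1 - t) * g x + t * g y"
  shows "g x + D \<bullet> (y - x) + K \<le> g y"
proof -
  have lim: "((\<lambda>t. (g (x + t *\<^sub>R (y - x)) - g x) / t + K * (1 - t)) \<longlongrightarrow>
      D \<bullet> (y - x) + K * (1 - 0)) (at_right 0)"
    by (intro tendsto_intros GDERIV_directional[OF D])
  have "D \<bullet> (y - x) + K * (1 - 0) \<le> g y - g x"
  proof (rule tendsto_upperbound[OF lim])
    show "\<forall>\<^sub>F t in at_right 0. (g (x + t *\<^sub>R (y - x)) - g x) / t + K * (1 - t) \<le> g y - g x"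
      using eventually_at_right_0_1
    proof eventually_elim
      case (elim t)
      with chord[of t] show ?case
        by (simp add: field_simps)
    qed
  qed simp
  then show ?thesis
    by simp
qed

text \<open>
  Near \<open>p\<close> on the segment towards \<open>y\<close>, the convex part lies below its chord and the smooth part is
  governed by its gradient; minimality at \<open>p\<close> bounds the slope of the chord. The error of the
  linearisation of \<open>k * h\<close> at \<open>p\<close> remains as a gain.
\<close>

lemma minimizer_growth:
  fixes g h :: "'a::real_inner \<Rightarrow> real"
  assumes g: "convex_on C g" and h: "GDERIV h p :> D" and k: "k \<ge> 0"
    and p: "p \<in> C" "\<And>z. z \<in> C \<Longrightarrow> g p + k * h p \<le> g z + k * h z"
    and y: "y \<in> C"
  shows "g p + k * h p + k * (h y - h p - D \<bullet> (y - p)) \<le> g y + k * h y"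
proof -
  have "((\<lambda>t. k * ((h (p + t *\<^sub>R (y - p)) - h p) / t)) \<longlongrightarrow> k * (D \<bullet> (y - p))) (at_right 0)"
    by (intro tendsto_intros GDERIV_directional[OF h])
  then have "g p - g y \<le> k * (D \<bullet> (y - p))"
  proof (rule tendsto_lowerbound)
    show "\<forall>\<^sub>F t in at_right 0. g p - g y \<le> k * ((h (p + t *\<^sub>R (y - p)) - h p) / t)"
      using eventually_at_right_0_1
    proof eventually_elim
      case (elim t)
      define z where "z = p + t *\<^sub>R (y - p)"
      have z: "z = (1 - t) *\<^sub>R p + t *\<^sub>R y"
        by (simp add: z_def algebra_simps)
      have "z \<in> C"
        using convex_on_imp_convex[OF g] p y elim unfolding z by (intro convexD) auto
      then have "g p + k * h p \<le> g z + k * h z"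
        by (rule p(2))
      moreover have "g z \<le> (1 - t) * g p + t * g y"
        using convex_onD[OF g, of t p y] p y elim unfolding z by simp
      ultimately have "t * (g p - g y) \<le> k * (h z - h p)"
        by (simp add: algebra_simps)
      with elim show ?case
        by (simp add: z_def field_simps)
    qed
  qed simp
  then show ?thesis
    by (simp add: algebra_simps)
qed

lemma convex_on_if_subgradients:
  assumes "convex C"
    and "\<And>x y. x \<in> C \<Longrightarrow> y \<in> C \<Longrightarrow> g x + s x \<bullet> (y - x) \<le> g y"
  shows "convex_on C g"
proof (rule convex_onI)
  fix t x y assume t: "0 < t" "t < (1::real)" and xy: "x \<in> C" "y \<in> C"
  define z where "z = (1 - t) *\<^sub>R x + t *\<^sub>R y"
  have z: "z \<in> C"
    using assms(1) t xy unfolding z_def by (intro convexD) auto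
  have "(1 - t) *\<^sub>R (x - z) + t *\<^sub>R (y - z) = 0"
    by (simp add: z_def algebra_simps)
  then have "(1 - t) * (s z \<bullet> (x - z)) + t * (s z \<bullet> (y - z)) = 0"
    by (metis inner_add_right inner_scaleR_right inner_zero_right)
  moreover have "(1 - t) * (g z + s z \<bullet> (x - z)) + t * (g z + s z \<bullet> (y - z))
      \<le> (1 - t) * g x + t * g y"
    using t assms(2)[OF z] xy by (intro add_mono mult_left_mono) auto
  moreover have "(1 - t) * (g z + a) + t * (g z + b) = g z + ((1 - t) * a + t * b)" for a b
    by (simp add: algebra_simps)
  ultimately show "g ((1 - t) *\<^sub>R x + t *\<^sub>R y) \<le> (1 - t) * g x + t * g y"
    by (simp add: z_def[symmetric])
qed (use assms in auto)


section \<open>Legendre functions and minimisers of tilted objectives\<close>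

lemma eff_dom_finite:
  assumes "x \<in> eff_dom g" "g x \<noteq> -\<infinity>"
  obtains a where "g x = ereal a"
  using assms by (cases "g x") (auto simp: eff_dom_def)

locale legendre_strongly_convex =
  fixes \<Phi> :: "'a::euclidean_space \<Rightarrow> ereal" and N :: "'a \<Rightarrow> real"
  assumes legendre: "legendre \<Phi>"
    and N_norm: "is_norm N"
    and strongly_convex: "strongly_convex_fun 1 N \<Phi>"
begin

abbreviation "U \<equiv> interior (eff_dom \<Phi>)"
abbreviation "phi y \<equiv> real_of_ereal (\<Phi> y)"
abbreviation "D y x \<equiv> phi y - phi x - egrad \<Phi> x \<bullet> (y - x)"

lemma Phi_not_minf: "\<Phi> x \<noteq> -\<infinity>"
  using legendre by (simp add: legendre_def)

lemma Phi_finite: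
  assumes "x \<in> eff_dom \<Phi>"
  obtains a where "\<Phi> x = ereal a"
  using eff_dom_finite[OF assms Phi_not_minf] by blast

lemma U_subset: "U \<subseteq> eff_dom \<Phi>"
  by (rule interior_subset)

lemma Phi_lsc: "lsc \<Phi>"
  using legendre by (simp add: legendre_def closed_fun_imp_lsc)

lemma phi_strong:
  assumes "x \<in> eff_dom \<Phi>" "y \<in> eff_dom \<Phi>" "u \<ge> 0" "v \<ge> 0" "u + v = 1"
  shows "u *\<^sub>R x + v *\<^sub>R y \<in> eff_dom \<Phi>"
    and "phi (u *\<^sub>R x + v *\<^sub>R y) + 1 / 2 * u * v * (N (x - y))\<^sup>2 \<le> u * phi x + v * phi y"
proof -
  have *: "\<Phi> (u *\<^sub>R x + v *\<^sub>R y) + ereal (1 / 2 * u * v * (N (x - y))\<^sup>2)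
      \<le> ereal (u * phi x + v * phi y)"
  proof -
    have "\<Phi> (u *\<^sub>R x + v *\<^sub>R y) + ereal (1 / 2 * u * v * (N (x - y))\<^sup>2)
        \<le> ereal u * \<Phi> x + ereal v * \<Phi> y"
      by (rule strongly_convex[unfolded strongly_convex_fun_def, rule_format, OF assms(3-5)])
    also have "\<dots> = ereal (u * phi x + v * phi y)"
      by (rule Phi_finite[OF assms(1)], rule Phi_finite[OF assms(2)]) simp
    finally show ?thesis .
  qed
  define z where "z = u *\<^sub>R x + v *\<^sub>R y"
  obtain a where a: "\<Phi> z = ereal a"
    using * Phi_not_minf[of z] unfolding z_def[symmetric] by (cases "\<Phi> z") simp_all
  show "u *\<^sub>R x + v *\<^sub>R y \<in> eff_dom \<Phi>"
    unfolding z_def[symmetric] eff_dom_def by (simp add: a)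
  show "phi (u *\<^sub>R x + v *\<^sub>R y) + 1 / 2 * u * v * (N (x - y))\<^sup>2 \<le> u * phi x + v * phi y"
    using * unfolding z_def[symmetric] a plus_ereal.simps ereal_less_eq real_of_ereal.simps .
qed

lemma dom_convex: "convex (eff_dom \<Phi>)"
  by (intro convexI phi_strong)

lemma phi_chord:
  assumes "x \<in> eff_dom \<Phi>" "y \<in> eff_dom \<Phi>" "0 \<le> t" "t \<le> 1"
  shows "phi (x + t *\<^sub>R (y - x)) \<le> (1 - t) * phi x + t * phi y"
proof -
  have "0 \<le> 1 / 2 * (1 - t) * t * (N (x - y))\<^sup>2"
    using assms by simp
  moreover have "phi ((1 - t) *\<^sub>R x + t *\<^sub>R y) + 1 / 2 * (1 - t) * t * (N (x - y))\<^sup>2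
      \<le> (1 - t) * phi x + t * phi y"
    using assms by (intro phi_strong(2)) auto
  ultimately have "phi ((1 - t) *\<^sub>R x + t *\<^sub>R y) \<le> (1 - t) * phi x + t * phi y"
    by linarith
  moreover have "(1 - t) *\<^sub>R x + t *\<^sub>R y = x + t *\<^sub>R (y - x)"
    by (simp add: algebra_simps)
  ultimately show ?thesis
    by (simp only:)
qed

lemma segment_in_dom:
  assumes "x \<in> eff_dom \<Phi>" "y \<in> eff_dom \<Phi>" "0 \<le> t" "t \<le> 1"
  shows "x + t *\<^sub>R (y - x) \<in> eff_dom \<Phi>"
  using phi_strong(1)[of x y "1 - t" t] assms by (simp add: algebra_simps)

lemma segment_in_U:
  assumes "x \<in> eff_dom \<Phi>" "z \<in> U" "0 < t" "t \<le> 1"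
  shows "x + t *\<^sub>R (z - x) \<in> U"
  using mem_interior_closure_convex_shrink[OF dom_convex assms(2), of x t] assms
    closure_subset[of "eff_dom \<Phi>"] by (auto simp: algebra_simps)

lemma phi_GDERIV: "x \<in> U \<Longrightarrow> GDERIV phi x :> egrad \<Phi> x"
  using legendre by (intro differentiable_imp_GDERIV_grad) (auto simp: legendre_def)

lemma D_ge:
  assumes x: "x \<in> U" and y: "y \<in> eff_dom \<Phi>"
  shows "1 / 2 * (N (y - x))\<^sup>2 \<le> D y x"
proof -
  have "phi x + egrad \<Phi> x \<bullet> (y - x) + 1 / 2 * (N (y - x))\<^sup>2 \<le> phi y"
  proof (rule gradient_inequality[OF phi_GDERIV[OF x]])
    fix t :: real assume t: "0 < t" "t < 1"
    have "(1 - t) *\<^sub>R x + t *\<^sub>R y = x + t *\<^sub>R (y - x)"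
      by (simp add: algebra_simps)
    then show "phi (x + t *\<^sub>R (y - x)) + 1 / 2 * (N (y - x))\<^sup>2 * t * (1 - t)
        \<le> (1 - t) * phi x + t * phi y"
      using phi_strong(2)[of x y "1 - t" t] t x y U_subset is_norm_minus_commute[OF N_norm, of x y]
      by (auto simp: mult_ac)
  qed
  then show ?thesis
    by simp
qed

lemma D_nonneg: "x \<in> U \<Longrightarrow> y \<in> eff_dom \<Phi> \<Longrightarrow> 0 \<le> D y x"
  by (rule order_trans[OF _ D_ge]) simp_all

lemma bregman_eq_D:
  assumes "x \<in> U" "y \<in> eff_dom \<Phi>"
  shows "bregman \<Phi> y x = ereal (D y x)"
proof -
  from assms U_subset have "x \<in> eff_dom \<Phi>"
    by blast
  from Phi_finite[OF this] Phi_finite[OF assms(2)] obtain a b where "\<Phi> x = ereal a" "\<Phi> y = ereal b"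
    by metis
  then show ?thesis
    by (simp add: bregman_def)
qed

text \<open>
  Essential smoothness: towards an interior point \<open>z\<close>, the function descends from a boundary point
  of its domain with infinite slope. If the slope were finite, the directional derivatives along
  the segment would be bounded below; as the function is bounded above on a ball around \<open>z\<close>, the
  gradient inequality at points of the segment would then bound the full gradients, which have to
  blow up at the boundary.
\<close>

lemma no_finite_slope_at_boundary:
  assumes y: "y \<in> eff_dom \<Phi>" "y \<notin> U" and z: "z \<in> U" and d: "\<delta> > 0"
    and slope: "\<And>t. 0 < t \<Longrightarrow> t < \<delta> \<Longrightarrow> phi y - t * K \<le> phi (y + t *\<^sub>R (z - y))"
  shows False
proof -
  obtain e where e: "e > 0" "cball z e \<subseteq> U"
    using z open_contains_cball[of U] by auto
  have "continuous_on (cball z e) phi"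
  proof (rule continuous_at_imp_continuous_on, rule ballI)
    fix x assume "x \<in> cball z e"
    then show "isCont phi x"
      using has_derivative_continuous[OF phi_GDERIV[of x, unfolded gderiv_def]] e by auto
  qed
  then have "\<exists>b\<in>cball z e. \<forall>x\<in>cball z e. phi x \<le> phi b"
    using e by (intro continuous_attains_sup) auto
  then obtain B where B: "\<And>x. x \<in> cball z e \<Longrightarrow> phi x \<le> B"
    by blast
  define A where "A = phi z - \<bar>egrad \<Phi> z \<bullet> (y - z)\<bar>"
  \<comment> \<open>The points \<open>x k\<close> on the segment approach \<open>y\<close>; the factor keeps every \<open>t k\<close> below \<open>\<delta>\<close> and \<open>1\<close>.\<close>
  define t where "t k = min (1/2) (\<delta>/2) / real (Suc k)" for k
  have "t k \<le> min (1/2) (\<delta>/2)" for k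
  proof -
    have "min (1/2) (\<delta>/2) / real (Suc k) \<le> min (1/2) (\<delta>/2) / 1"
      using d by (intro divide_left_mono) auto
    then show ?thesis
      by (simp add: t_def)
  qed
  moreover have "min (1/2) (\<delta>/2) < 1" "min (1/2) (\<delta>/2) < \<delta>"
    using d by auto
  ultimately have t1: "t k < 1" "t k < \<delta>" for k
    by (meson le_less_trans)+
  have t0: "0 < t k" for k
    using d by (simp add: t_def)
  have t: "0 < t k" "t k < 1" "t k < \<delta>" for k
    using t0 t1 by blast+
  have t_lim: "t \<longlonglongrightarrow> 0"
    unfolding t_def using LIMSEQ_Suc[OF lim_const_over_n] .
  define x where "x k = y + t k *\<^sub>R (z - y)" for k
  have xU: "x k \<in> U" for k
    unfolding x_def using t[of k] y z by (intro segment_in_U) auto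
  have "x \<longlonglongrightarrow> y + 0 *\<^sub>R (z - y)"
    unfolding x_def by (intro tendsto_intros t_lim)
  moreover have "y \<in> frontier (eff_dom \<Phi>)"
    using y closure_subset[of "eff_dom \<Phi>"] by (auto simp: frontier_def)
  moreover have "\<forall>xs. \<forall>y\<in>frontier (eff_dom \<Phi>). (\<forall>k. xs k \<in> U) \<and> xs \<longlonglongrightarrow> y \<longrightarrow>
      filterlim (\<lambda>k. norm (egrad \<Phi> (xs k))) at_top sequentially"
    using legendre unfolding legendre_def by (elim conjE)
  ultimately have blowup: "filterlim (\<lambda>k. norm (egrad \<Phi> (x k))) at_top sequentially"
    using xU by (elim allE[of _ x] ballE[of _ _ y]) simp_all
  have bound: "norm (egrad \<Phi> (x k)) \<le> (B - A + \<bar>K\<bar>) / e" for k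
  proof -
    define g where "g = egrad \<Phi> (x k)"
    have "phi y \<ge> phi (x k) + g \<bullet> (y - x k)"
      using D_nonneg[OF xU[of k] y(1)] by (simp add: g_def)
    moreover have "g \<bullet> (y - x k) = - (t k * (g \<bullet> (z - y)))"
      by (simp add: x_def algebra_simps)
    moreover have "phi y - t k * K \<le> phi (x k)"
      unfolding x_def using t by (intro slope)
    ultimately have "t k * (- K) \<le> t k * (g \<bullet> (z - y))"
      by simp
    then have dir: "- K \<le> g \<bullet> (z - y)"
      using t(1) by (rule mult_left_le_imp_le)
    have "(1 - t k) * (g \<bullet> (z - y)) \<ge> - \<bar>K\<bar>"
    proof (cases "g \<bullet> (z - y) \<ge> 0")
      case False
      then have "(1 - t k) * (g \<bullet> (z - y)) \<ge> 1 * (g \<bullet> (z - y))"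
        using t[of k] by (intro mult_right_mono_neg) auto
      then show ?thesis using dir by linarith
    next
      case True
      then have "0 \<le> (1 - t k) * (g \<bullet> (z - y))"
        using t[of k] by simp
      then show ?thesis by linarith
    qed
    moreover have "phi (x k) \<ge> A"
    proof -
      have "phi (x k) \<ge> phi z + egrad \<Phi> z \<bullet> (x k - z)"
        using D_nonneg[OF z, of "x k"] xU[of k] U_subset by auto
      moreover have "x k - z = (1 - t k) *\<^sub>R (y - z)"
        by (simp add: x_def algebra_simps)
      moreover have "\<bar>(1 - t k) * (egrad \<Phi> z \<bullet> (y - z))\<bar> \<le> 1 * \<bar>egrad \<Phi> z \<bullet> (y - z)\<bar>"
        unfolding abs_mult using t[of k] by (intro mult_right_mono) auto
      ultimately show ?thesis
        by (simp add: A_def)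
    qed
    moreover have "phi (x k) + (1 - t k) * (g \<bullet> (z - y)) + e * norm g \<le> B"
    proof -
      \<comment> \<open>The point of the ball in the direction of the gradient detects its norm.\<close>
      define u where "u = z + e *\<^sub>R sgn g"
      have "u \<in> cball z e"
        using e by (simp add: u_def dist_norm norm_sgn)
      then have "phi u \<le> B" "u \<in> eff_dom \<Phi>"
        using B e U_subset by auto
      moreover from this have "phi (x k) + g \<bullet> (u - x k) \<le> phi u"
        using D_nonneg[OF xU[of k], of u] by (simp add: g_def)
      moreover have "u - x k = (1 - t k) *\<^sub>R (z - y) + e *\<^sub>R sgn g"
        by (simp add: u_def x_def algebra_simps)
      moreover have "g \<bullet> sgn g = norm g"
        by (cases "g = 0") (simp_all add: sgn_div_norm dot_square_norm power2_eq_square)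
      ultimately show ?thesis
        by (simp add: inner_add_right)
    qed
    ultimately have "e * norm g \<le> B - A + \<bar>K\<bar>"
      by linarith
    then show ?thesis
      using e by (simp add: g_def field_simps)
  qed
  from blowup have "\<forall>\<^sub>F k in sequentially. (B - A + \<bar>K\<bar>) / e < norm (egrad \<Phi> (x k))"
    by (simp add: filterlim_at_top_dense)
  then obtain k where "(B - A + \<bar>K\<bar>) / e < norm (egrad \<Phi> (x k))"
    using eventually_happens by fastforce
  with bound[of k] show False
    by linarith
qed

end

definition tilted :: "('a::real_inner \<Rightarrow> ereal) \<Rightarrow> ('a \<Rightarrow> ereal) \<Rightarrow> real \<Rightarrow> 'a \<Rightarrow> 'a \<Rightarrow> ereal" where
  "tilted \<Phi> \<psi> c v y = \<psi> y + ereal c * \<Phi> y - ereal (v \<bullet> y)"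

definition tilted_argmin :: "('a::real_inner \<Rightarrow> ereal) \<Rightarrow> ('a \<Rightarrow> ereal) \<Rightarrow> real \<Rightarrow> 'a \<Rightarrow> 'a" where
  "tilted_argmin \<Phi> \<psi> c v = arg_min (tilted \<Phi> \<psi> c v) (\<lambda>_. True)"

text \<open>
  A proximal step and a mirror descent step both minimise a function \<open>\<psi>\<close> plus a multiple of the
  mirror map, minus a linear function; this locale treats them together.
  The parameter \<open>\<mu>\<close> measures the relative weak convexity of \<open>\<psi>\<close>, but only inside the domain of the
  mirror map; \<open>m\<close> measures how fast \<open>\<psi>\<close> may tend to \<open>-\<infinity>\<close>. For the regulariser these are \<open>\<rho>\<close>
  and \<open>M\<close>, for the full objective \<open>\<rho> + \<tau>\<close> and \<open>0\<close>. Boundary points of the domain, where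
  convexity need not hold, are handled through the bound \<open>slope\<close>.
\<close>

locale relatively_weakly_convex = legendre_strongly_convex \<Phi> N
  for \<Phi> :: "'a::euclidean_space \<Rightarrow> ereal" and N :: "'a \<Rightarrow> real" +
  fixes \<psi> :: "'a \<Rightarrow> ereal" and \<mu> m :: real and x0 :: 'a
  assumes psi_not_minf: "\<psi> x \<noteq> -\<infinity>"
    and psi_lsc: "lsc \<psi>"
    and psi_dom_convex: "convex (eff_dom \<psi>)"
    and x0: "x0 \<in> interior (eff_dom \<Phi>) \<inter> eff_dom \<psi>"
    and psi_convex: "convex_on (interior (eff_dom \<Phi>) \<inter> eff_dom \<psi>)
        (\<lambda>y. real_of_ereal (\<psi> y) + \<mu> * real_of_ereal (\<Phi> y))"
    and psi_lower: "\<exists>b w. \<forall>y\<in>eff_dom \<Phi> \<inter> eff_dom \<psi>.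
        b + w \<bullet> (y - x0) - m * (real_of_ereal (\<Phi> y) - real_of_ereal (\<Phi> x0) - egrad \<Phi> x0 \<bullet> (y - x0))
          \<le> real_of_ereal (\<psi> y)"
    and slope: "\<And>y. y \<in> eff_dom \<Phi> \<inter> eff_dom \<psi> \<Longrightarrow> \<exists>K. \<exists>\<delta>>0. \<forall>t. 0 < t \<and> t < \<delta> \<longrightarrow>
        real_of_ereal (\<psi> (y + t *\<^sub>R (x0 - y))) + \<mu> * real_of_ereal (\<Phi> (y + t *\<^sub>R (x0 - y)))
          \<le> real_of_ereal (\<psi> y) + \<mu> * real_of_ereal (\<Phi> y) + t * K"
begin

abbreviation "psi y \<equiv> real_of_ereal (\<psi> y)"
abbreviation "C \<equiv> U \<inter> eff_dom \<psi>"

lemma psi_finite: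
  assumes "x \<in> eff_dom \<psi>"
  obtains a where "\<psi> x = ereal a"
  using eff_dom_finite[OF assms psi_not_minf] by blast

lemma C_convex: "convex C"
  using dom_convex psi_dom_convex by (intro convex_Int convex_interior)

lemma tilted_eq:
  assumes "y \<in> eff_dom \<Phi>" "y \<in> eff_dom \<psi>"
  shows "tilted \<Phi> \<psi> c v y = ereal (psi y + c * phi y - v \<bullet> y)"
  by (rule Phi_finite[OF assms(1)], rule psi_finite[OF assms(2)]) (simp add: tilted_def)

lemma tilted_infinite:
  assumes "c > 0" "\<not> (y \<in> eff_dom \<Phi> \<and> y \<in> eff_dom \<psi>)"
  shows "tilted \<Phi> \<psi> c v y = \<infinity>"
  using assms Phi_not_minf[of y] psi_not_minf[of y]
  by (cases "\<Phi> y"; cases "\<psi> y") (auto simp: tilted_def eff_dom_def)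

text \<open>
  Rewriting the mirror map as its divergence from \<open>x0\<close> plus an affine function shows that the
  surplus \<open>c - m\<close> makes the tilted objective coercive.
\<close>

lemma tilted_has_minimizer:
  assumes c: "c > 0" "c > m"
  shows "\<exists>p. \<forall>y. tilted \<Phi> \<psi> c v p \<le> tilted \<Phi> \<psi> c v y"
proof -
  obtain b w where bw: "\<And>y. y \<in> eff_dom \<Phi> \<Longrightarrow> y \<in> eff_dom \<psi> \<Longrightarrow>
      b + w \<bullet> (y - x0) - m * D y x0 \<le> psi y"
    using psi_lower by blast
  obtain k where k: "k > 0" "\<And>x. k * norm x \<le> N x"
    using is_norm_ge_norm[OF N_norm] by blast
  define A where "A = b + c * phi x0 - v \<bullet> x0"
  define a where "a = w + c *\<^sub>R egrad \<Phi> x0 - v"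
  define l where "l = (c - m) * (1 / 2 * k\<^sup>2)"
  have "lsc (\<lambda>y. \<psi> y + ereal c * \<Phi> y)"
    using c Phi_not_minf psi_not_minf
    by (intro lsc_add lsc_cmult psi_lsc Phi_lsc)
      (auto simp: ereal_mult_eq_MInfty)
  moreover have "lsc (\<lambda>y. ereal (- (v \<bullet> y)))"
    by (intro lsc_continuous continuous_intros)
  moreover have "\<psi> y + ereal c * \<Phi> y \<noteq> -\<infinity>" for y
    using c Phi_not_minf[of y] psi_not_minf[of y] by (cases "\<Phi> y"; cases "\<psi> y") auto
  ultimately have "lsc (\<lambda>y. \<psi> y + ereal c * \<Phi> y + ereal (- (v \<bullet> y)))"
    by (rule lsc_add) simp
  moreover have "(\<lambda>y. \<psi> y + ereal c * \<Phi> y + ereal (- (v \<bullet> y))) = tilted \<Phi> \<psi> c v"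
    by (rule ext) (simp add: tilted_def minus_ereal_def)
  ultimately have "lsc (tilted \<Phi> \<psi> c v)"
    by simp
  then show ?thesis
  proof (rule lsc_coercive_attains_min[where k = l and z = x0])
    show "l > 0"
      using c k by (simp add: l_def)
    show "tilted \<Phi> \<psi> c v x0 < \<infinity>"
      using x0 U_subset by (subst tilted_eq) auto
    fix y
    show "ereal (A + a \<bullet> (y - x0) + l * (norm (y - x0))\<^sup>2) \<le> tilted \<Phi> \<psi> c v y"
    proof (cases "y \<in> eff_dom \<Phi> \<and> y \<in> eff_dom \<psi>")
      case True
      have "(k * norm (y - x0))\<^sup>2 \<le> (N (y - x0))\<^sup>2"
        using k by (intro power_mono) auto
      then have "1 / 2 * k\<^sup>2 * (norm (y - x0))\<^sup>2 \<le> D y x0"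
        using D_ge[of x0 y] x0 True by (auto simp: power_mult_distrib)
      then have "l * (norm (y - x0))\<^sup>2 \<le> (c - m) * D y x0"
        using c unfolding l_def mult.assoc[of "c - m"] by (intro mult_left_mono) auto
      also have "\<dots> = c * (phi y - phi x0 - egrad \<Phi> x0 \<bullet> (y - x0)) - m * D y x0"
        by (simp add: algebra_simps)
      finally have "A + a \<bullet> (y - x0) + l * (norm (y - x0))\<^sup>2 \<le> psi y + c * phi y - v \<bullet> y"
        using bw[of y] True
        by (simp add: A_def a_def inner_add_left inner_diff_left inner_diff_right right_diff_distrib)
      then show ?thesis
        using True by (subst tilted_eq) auto
    next
      case False
      then show ?thesis
        using c tilted_infinite by simp
    qed
  qed
qed

text \<open>A boundary point is not a minimiser, because the mirror map descends from it infinitely fast.\<close>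

lemma minimizer_in_C:
  assumes c: "c > 0" "c > \<mu>" and p: "\<And>y. tilted \<Phi> \<psi> c v p \<le> tilted \<Phi> \<psi> c v y"
  shows "p \<in> C"
proof -
  have "tilted \<Phi> \<psi> c v p \<noteq> \<infinity>"
    using p[of x0] x0 U_subset tilted_eq[of x0 c v] by auto
  then have dom: "p \<in> eff_dom \<Phi>" "p \<in> eff_dom \<psi>"
    using tilted_infinite[OF c(1), of p v] by blast+
  have "p \<in> U"
  proof (rule ccontr)
    assume "p \<notin> U"
    obtain K \<delta> where K: "\<delta> > 0" "\<And>t. 0 < t \<Longrightarrow> t < \<delta> \<Longrightarrow>
        psi (p + t *\<^sub>R (x0 - p)) + \<mu> * phi (p + t *\<^sub>R (x0 - p)) \<le> psi p + \<mu> * phi p + t * K"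
      using slope[of p] dom by blast
    have "phi p - t * ((K - v \<bullet> (x0 - p)) / (c - \<mu>)) \<le> phi (p + t *\<^sub>R (x0 - p))"
      if t: "0 < t" "t < min \<delta> 1" for t
    proof -
      define q where "q = p + t *\<^sub>R (x0 - p)"
      have "q \<in> eff_dom \<Phi>"
        unfolding q_def using t dom x0 U_subset by (intro segment_in_dom) auto
      moreover have "q \<in> eff_dom \<psi>"
        using convexD_alt[OF psi_dom_convex dom(2), of x0 t] x0 t
        by (simp add: q_def algebra_simps)
      ultimately have "psi p + c * phi p - v \<bullet> p \<le> psi q + c * phi q - v \<bullet> q"
        using p[of q] dom by (simp add: tilted_eq)
      moreover have "v \<bullet> q = v \<bullet> p + t * (v \<bullet> (x0 - p))"
        by (simp add: q_def inner_add_right)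
      moreover have "psi q + \<mu> * phi q \<le> psi p + \<mu> * phi p + t * K"
        unfolding q_def using t by (intro K) auto
      ultimately have "t * (v \<bullet> (x0 - p) - K) \<le> (c - \<mu>) * (phi q - phi p)"
        by (simp add: algebra_simps)
      then show ?thesis
        using c unfolding q_def[symmetric] by (simp add: field_simps)
    qed
    moreover have "x0 \<in> U" "0 < min \<delta> 1"
      using x0 K(1) by auto
    ultimately show False
      using no_finite_slope_at_boundary[OF dom(1) \<open>p \<notin> U\<close>] by blast
  qed
  with dom show ?thesis
    by blast
qed

lemma tilted_argmin_minimal:
  assumes "c > 0" "c > m"
  shows "tilted \<Phi> \<psi> c v (tilted_argmin \<Phi> \<psi> c v) \<le> tilted \<Phi> \<psi> c v y"
proof -
  obtain p where "is_arg_min (tilted \<Phi> \<psi> c v) (\<lambda>_. True) p"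
    using tilted_has_minimizer[OF assms, of v] by (auto simp: is_arg_min_linorder)
  then have "is_arg_min (tilted \<Phi> \<psi> c v) (\<lambda>_. True) (tilted_argmin \<Phi> \<psi> c v)"
    unfolding tilted_argmin_def arg_min_def by (rule someI)
  then show ?thesis
    by (auto simp: is_arg_min_linorder)
qed

context
  fixes c :: real
  assumes c: "c > 0" "c > \<mu>" "c > m"
begin

lemma tilted_argmin_in_C: "tilted_argmin \<Phi> \<psi> c v \<in> C"
  using c by (intro minimizer_in_C[of c v] tilted_argmin_minimal) auto

lemma tilted_argmin_growth:
  fixes v y :: 'a
  assumes y: "y \<in> C"
  defines "p \<equiv> tilted_argmin \<Phi> \<psi> c v"
  shows "psi p + c * phi p - v \<bullet> p + (c - \<mu>) * D y p \<le> psi y + c * phi y - v \<bullet> y"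
proof -
  have p: "p \<in> C"
    unfolding p_def by (rule tilted_argmin_in_C)
  have "convex_on C (\<lambda>y. - (v \<bullet> y))"
  proof (rule convex_onI)
    show "- (v \<bullet> ((1 - t) *\<^sub>R x + t *\<^sub>R y)) \<le> (1 - t) * - (v \<bullet> x) + t * - (v \<bullet> y)" for t x y
      by (simp add: inner_add_right)
  qed (rule C_convex)
  then have g: "convex_on C (\<lambda>y. psi y + \<mu> * phi y + - (v \<bullet> y))"
    by (rule convex_on_add[OF psi_convex])
  have min: "psi p + \<mu> * phi p + - (v \<bullet> p) + (c - \<mu>) * phi p
      \<le> psi z + \<mu> * phi z + - (v \<bullet> z) + (c - \<mu>) * phi z" if "z \<in> C" for z
  proof -
    have "z \<in> eff_dom \<Phi>" "z \<in> eff_dom \<psi>" "p \<in> eff_dom \<Phi>" "p \<in> eff_dom \<psi>"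
      using that p U_subset by blast+
    then have "psi p + c * phi p - v \<bullet> p \<le> psi z + c * phi z - v \<bullet> z"
      using tilted_argmin_minimal[OF c(1,3), of v z] unfolding p_def[symmetric]
      by (simp add: tilted_eq)
    then show ?thesis
      by (simp add: left_diff_distrib)
  qed
  have "GDERIV phi p :> egrad \<Phi> p"
    using p by (intro phi_GDERIV) auto
  then have "psi p + \<mu> * phi p + - (v \<bullet> p) + (c - \<mu>) * phi p + (c - \<mu>) * D y p
      \<le> psi y + \<mu> * phi y + - (v \<bullet> y) + (c - \<mu>) * phi y"
    using c by (intro minimizer_growth[OF g _ _ p min y]) auto
  moreover have "\<mu> * phi z + (c - \<mu>) * phi z = c * phi z" for z
    by (simp add: left_diff_distrib)
  ultimately show ?thesis
    by (smt (verit, best))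
qed

text \<open>
  Adding the growth inequalities for two tilts gives strong monotonicity, hence the minimiser is
  a Lipschitz function of the tilt. Measurability of the algorithm rests on this.
\<close>

lemma tilted_argmin_continuous: "continuous_on UNIV (tilted_argmin \<Phi> \<psi> c)"
proof -
  obtain k where k: "k > 0" "\<And>x. k * norm x \<le> N x"
    using is_norm_ge_norm[OF N_norm] by blast
  define L where "L = 1 / ((c - \<mu>) * k\<^sup>2)"
  have "L-lipschitz_on UNIV (tilted_argmin \<Phi> \<psi> c)"
  proof (rule lipschitz_onI)
    show "L \<ge> 0"
      using c by (simp add: L_def)
    fix v w
    define p q where "p = tilted_argmin \<Phi> \<psi> c v" and "q = tilted_argmin \<Phi> \<psi> c w"
    have pq: "p \<in> C" "q \<in> C"
      by (simp_all only: p_def q_def tilted_argmin_in_C)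
    have "psi p + c * phi p - v \<bullet> p + (c - \<mu>) * D q p \<le> psi q + c * phi q - v \<bullet> q"
      using tilted_argmin_growth[OF pq(2), of v] by (simp add: p_def)
    moreover have "psi q + c * phi q - w \<bullet> q + (c - \<mu>) * D p q \<le> psi p + c * phi p - w \<bullet> p"
      using tilted_argmin_growth[OF pq(1), of w] by (simp add: q_def)
    ultimately have "(c - \<mu>) * (D q p + D p q) \<le> (v - w) \<bullet> (p - q)"
      unfolding inner_diff_left inner_diff_right distrib_left by linarith
    moreover have "k\<^sup>2 * (norm (p - q))\<^sup>2 \<le> D q p + D p q"
    proof -
      have "(k * norm (p - q))\<^sup>2 \<le> (N (p - q))\<^sup>2"
        using k by (intro power_mono) auto
      moreover have "1 / 2 * (N (p - q))\<^sup>2 \<le> D q p" "1 / 2 * (N (p - q))\<^sup>2 \<le> D p q"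
        using D_ge[of p q] D_ge[of q p] pq U_subset is_norm_minus_commute[OF N_norm, of p q] by auto
      ultimately show ?thesis
        by (simp add: power_mult_distrib)
    qed
    then have "(c - \<mu>) * (k\<^sup>2 * (norm (p - q))\<^sup>2) \<le> (c - \<mu>) * (D q p + D p q)"
      using c by (intro mult_left_mono) auto
    ultimately have "(c - \<mu>) * (k\<^sup>2 * (norm (p - q))\<^sup>2) \<le> norm (v - w) * norm (p - q)"
      using norm_cauchy_schwarz[of "v - w" "p - q"] by linarith
    then have "((c - \<mu>) * k\<^sup>2 * norm (p - q)) * norm (p - q) \<le> norm (v - w) * norm (p - q)"
      by (simp only: power2_eq_square mult.assoc)
    then have "(c - \<mu>) * k\<^sup>2 * norm (p - q) \<le> norm (v - w)"
      by (cases "p = q") (simp_all only: mult_le_cancel_right, simp_all)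
    moreover have "(c - \<mu>) * k\<^sup>2 > 0"
      using c k by simp
    ultimately have "dist p q \<le> L * dist v w"
      by (simp add: L_def dist_norm pos_le_divide_eq mult.commute)
    then show "dist (tilted_argmin \<Phi> \<psi> c v) (tilted_argmin \<Phi> \<psi> c w) \<le> L * dist v w"
      by (simp only: p_def q_def)
  qed
  then show ?thesis
    by (rule lipschitz_on_continuous_on)
qed

end

end


section \<open>The composite problem\<close>

lemma locally_lipschitz_continuous:
  assumes "locally_lipschitz f"
  shows "continuous_on UNIV f"
proof (rule continuous_at_imp_continuous_on, rule ballI)
  fix x
  obtain u L where "u > 0" "L-lipschitz_on (cball x u) f"
    using assms unfolding locally_lipschitz_def by blast
  moreover have "x \<in> interior (cball x u)"
    using \<open>u > 0\<close> by (intro interiorI[of "ball x u"]) auto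
  ultimately show "isCont f x"
    using continuous_on_interior lipschitz_on_continuous_on by blast
qed

locale composite_problem = legendre_strongly_convex \<Phi> N
  for \<Phi> :: "'a::euclidean_space \<Rightarrow> ereal" and N :: "'a \<Rightarrow> real" +
  fixes f :: "'a \<Rightarrow> real" and r :: "'a \<Rightarrow> ereal" and \<tau> M \<rho> :: real and x0 :: 'a
  assumes f_lipschitz: "locally_lipschitz f"
    and r_not_minf: "r x \<noteq> -\<infinity>"
    and r_closed: "closed_fun r"
    and r_dom_convex: "convex (eff_dom r)"
    and tau_nonneg: "\<tau> \<ge> 0" and M_nonneg: "M \<ge> 0"
    and model: "x \<in> interior (eff_dom \<Phi>) \<inter> eff_dom r \<Longrightarrow> y \<in> interior (eff_dom \<Phi>) \<inter> eff_dom r \<Longrightarrow>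
        ereal (- \<tau>) * bregman \<Phi> y x \<le> ereal (f y - f x - grad f x \<bullet> (y - x)) \<and>
        ereal (f y - f x - grad f x \<bullet> (y - x)) \<le> ereal M * bregman \<Phi> y x"
    and r_weakly_convex: "weakly_convex_rel \<rho> \<Phi> r"
    and F_attains_min: "\<exists>z. \<forall>x. objective f r z \<le> objective f r x"
    and x0: "x0 \<in> interior (eff_dom \<Phi>) \<inter> eff_dom r"
begin

abbreviation "F \<equiv> objective f r"
abbreviation "rr y \<equiv> real_of_ereal (r y)"
abbreviation "FF y \<equiv> f y + rr y"
abbreviation "C \<equiv> U \<inter> eff_dom r"

lemma r_finite:
  assumes "x \<in> eff_dom r"
  obtains a where "r x = ereal a"
  using eff_dom_finite[OF assms r_not_minf] by blast

lemma F_dom: "eff_dom F = eff_dom r"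
proof -
  have "F x < \<infinity> \<longleftrightarrow> r x < \<infinity>" for x
    by (cases "r x") (auto simp: objective_def)
  then show ?thesis
    by (simp add: eff_dom_def)
qed

lemma F_real: "x \<in> eff_dom r \<Longrightarrow> real_of_ereal (F x) = FF x"
  by (rule r_finite) (auto simp: objective_def)

lemma C_convex: "convex C"
  using dom_convex r_dom_convex by (intro convex_Int convex_interior)

lemma f_continuous: "continuous_on UNIV f"
  using f_lipschitz by (rule locally_lipschitz_continuous)

lemma model_lower: "x \<in> C \<Longrightarrow> y \<in> C \<Longrightarrow> f x + grad f x \<bullet> (y - x) - \<tau> * D y x \<le> f y"
  and model_upper: "x \<in> C \<Longrightarrow> y \<in> C \<Longrightarrow> f y \<le> f x + grad f x \<bullet> (y - x) + M * D y x"
proof -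
  assume xy: "x \<in> C" "y \<in> C"
  have "bregman \<Phi> y x = ereal (D y x)"
    using xy U_subset by (intro bregman_eq_D) auto
  with model[OF xy] have "- \<tau> * D y x \<le> f y - f x - grad f x \<bullet> (y - x)"
      "f y - f x - grad f x \<bullet> (y - x) \<le> M * D y x"
    by simp_all
  then show "f x + grad f x \<bullet> (y - x) - \<tau> * D y x \<le> f y"
      "f y \<le> f x + grad f x \<bullet> (y - x) + M * D y x"
    by simp_all
qed

lemma r_rho_convex: "convex_on (eff_dom \<Phi> \<inter> eff_dom r) (\<lambda>y. rr y + \<rho> * phi y)"
proof (rule convex_onI)
  show "convex (eff_dom \<Phi> \<inter> eff_dom r)"
    by (intro convex_Int dom_convex r_dom_convex)
  fix t x y
  assume t: "0 < t" "t < (1::real)" and xy: "x \<in> eff_dom \<Phi> \<inter> eff_dom r" "y \<in> eff_dom \<Phi> \<inter> eff_dom r"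
  define z where "z = (1 - t) *\<^sub>R x + t *\<^sub>R y"
  have z: "z \<in> eff_dom \<Phi> \<inter> eff_dom r"
    unfolding z_def using t xy by (intro convexD[OF \<open>convex _\<close>]) auto
  have fin: "r w + ereal \<rho> * \<Phi> w = ereal (rr w + \<rho> * phi w)" if "w \<in> eff_dom \<Phi> \<inter> eff_dom r" for w
  proof -
    from that have w: "w \<in> eff_dom \<Phi>" "w \<in> eff_dom r"
      by auto
    show ?thesis
      by (rule Phi_finite[OF w(1)], rule r_finite[OF w(2)]) simp
  qed
  have "r z + ereal \<rho> * \<Phi> z \<le> ereal (1 - t) * (r x + ereal \<rho> * \<Phi> x) + ereal t * (r y + ereal \<rho> * \<Phi> y)"
    unfolding z_def using t
    by (intro r_weakly_convex[unfolded weakly_convex_rel_def convex_fun_def, rule_format]) auto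
  then show "rr ((1 - t) *\<^sub>R x + t *\<^sub>R y) + \<rho> * phi ((1 - t) *\<^sub>R x + t *\<^sub>R y)
      \<le> (1 - t) * (rr x + \<rho> * phi x) + t * (rr y + \<rho> * phi y)"
    unfolding fin[OF z] fin[OF xy(1)] fin[OF xy(2)] z_def[symmetric] by simp
qed

lemma r_rho_chord:
  assumes "y \<in> eff_dom \<Phi> \<inter> eff_dom r" "0 \<le> t" "t \<le> 1"
  shows "rr (y + t *\<^sub>R (x0 - y)) + \<rho> * phi (y + t *\<^sub>R (x0 - y))
    \<le> rr y + \<rho> * phi y + t * ((rr x0 + \<rho> * phi x0) - (rr y + \<rho> * phi y))"
proof -
  have "rr ((1 - t) *\<^sub>R y + t *\<^sub>R x0) + \<rho> * phi ((1 - t) *\<^sub>R y + t *\<^sub>R x0)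
      \<le> (1 - t) * (rr y + \<rho> * phi y) + t * (rr x0 + \<rho> * phi x0)"
    using assms x0 U_subset by (intro convex_onD[OF r_rho_convex]) auto
  moreover have "(1 - t) *\<^sub>R y + t *\<^sub>R x0 = y + t *\<^sub>R (x0 - y)"
    by (simp add: algebra_simps)
  ultimately show ?thesis
    by (simp only:) (simp add: algebra_simps)
qed

lemma segment_in_C:
  assumes "y \<in> eff_dom \<Phi> \<inter> eff_dom r" "0 < t" "t \<le> 1"
  shows "y + t *\<^sub>R (x0 - y) \<in> C"
proof
  show "y + t *\<^sub>R (x0 - y) \<in> U"
    using assms x0 by (intro segment_in_U) auto
  show "y + t *\<^sub>R (x0 - y) \<in> eff_dom r"
    using convexD_alt[OF r_dom_convex, of y x0 t] assms x0 by (simp add: algebra_simps)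
qed

lemma F_min_real: "\<exists>b. \<forall>y\<in>eff_dom r. b \<le> FF y"
proof -
  obtain z where z: "\<And>x. F z \<le> F x"
    using F_attains_min by blast
  have "x0 \<in> eff_dom r"
    using x0 by simp
  then obtain a where "r x0 = ereal a"
    by (rule r_finite)
  with z[of x0] have "z \<in> eff_dom F"
    by (auto simp: eff_dom_def objective_def)
  then have "z \<in> eff_dom r"
    by (simp add: F_dom)
  then obtain b where b: "r z = ereal b"
    by (rule r_finite)
  have "f z + b \<le> FF y" if "y \<in> eff_dom r" for y
  proof -
    from that obtain a where "r y = ereal a"
      by (rule r_finite)
    with z[of y] b show ?thesis
      by (simp add: objective_def)
  qed
  then show ?thesis
    by blast
qed

text \<open>
  Points of the common domain are limits of points of \<open>C\<close> along segments towards \<open>x0\<close>; continuity of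
  \<open>f\<close> and convexity of the divergence carry the upper model at \<open>x0\<close> over to the limit.
\<close>

lemma model_upper_boundary:
  assumes y: "y \<in> eff_dom \<Phi> \<inter> eff_dom r"
  shows "f y \<le> f x0 + grad f x0 \<bullet> (y - x0) + M * D y x0"
proof -
  define q where "q t = y + t *\<^sub>R (x0 - y)" for t
  have "isCont f y"
    using f_continuous by (simp add: continuous_on_eq_continuous_at)
  moreover have "(q \<longlongrightarrow> y + 0 *\<^sub>R (x0 - y)) (at_right 0)"
    unfolding q_def by (intro tendsto_intros)
  ultimately have lim1: "((\<lambda>t. f (q t)) \<longlongrightarrow> f y) (at_right 0)"
    using isCont_tendsto_compose[of y f q] by simp
  have lim2: "((\<lambda>t. f x0 + (1 - t) * (grad f x0 \<bullet> (y - x0)) + M * ((1 - t) * D y x0)) \<longlongrightarrow>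
      f x0 + (1 - 0) * (grad f x0 \<bullet> (y - x0)) + M * ((1 - 0) * D y x0)) (at_right 0)"
    by (intro tendsto_intros)
  have "f y \<le> f x0 + (1 - 0) * (grad f x0 \<bullet> (y - x0)) + M * ((1 - 0) * D y x0)"
  proof (rule tendsto_le[OF _ lim2 lim1])
    show "\<forall>\<^sub>F t in at_right 0.
        f (q t) \<le> f x0 + (1 - t) * (grad f x0 \<bullet> (y - x0)) + M * ((1 - t) * D y x0)"
      using eventually_at_right_0_1
    proof eventually_elim
      case (elim t)
      have "f (q t) \<le> f x0 + grad f x0 \<bullet> (q t - x0) + M * D (q t) x0"
        unfolding q_def using elim y x0 by (intro model_upper segment_in_C) auto
      moreover have diff: "q t - x0 = (1 - t) *\<^sub>R (y - x0)"
        by (simp add: q_def algebra_simps)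
      moreover have "D (q t) x0 \<le> (1 - t) * D y x0"
      proof -
        have "phi (q t) \<le> (1 - t) * phi y + t * phi x0"
          unfolding q_def using elim y x0 U_subset by (intro phi_chord) auto
        then show ?thesis
          unfolding diff by (simp add: algebra_simps)
      qed
      then have "M * D (q t) x0 \<le> M * ((1 - t) * D y x0)"
        using M_nonneg by (rule mult_left_mono)
      ultimately show ?case
        by simp
    qed
  qed simp
  then show ?thesis
    by simp
qed

text \<open>
  The regulariser inherits its lower bound from the minimum of the objective: \<open>r\<close> is at least
  \<open>min F - f\<close>, and \<open>f\<close> is bounded above by its model at \<open>x0\<close>.
\<close>

sublocale reg: relatively_weakly_convex \<Phi> N r \<rho> M x0
proof unfold_locales
  show "r x \<noteq> -\<infinity>" for x
    by (rule r_not_minf)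
  show "lsc r"
    using r_closed by (rule closed_fun_imp_lsc)
  show "convex (eff_dom r)"
    by (rule r_dom_convex)
  show "x0 \<in> U \<inter> eff_dom r"
    by (rule x0)
  show "convex_on C (\<lambda>y. rr y + \<rho> * phi y)"
    using U_subset by (intro convex_on_subset[OF r_rho_convex] C_convex) auto
  obtain b where b: "\<And>y. y \<in> eff_dom r \<Longrightarrow> b \<le> FF y"
    using F_min_real by blast
  show "\<exists>b w. \<forall>y\<in>eff_dom \<Phi> \<inter> eff_dom r. b + w \<bullet> (y - x0) - M * D y x0 \<le> rr y"
  proof (intro exI ballI)
    fix y assume y: "y \<in> eff_dom \<Phi> \<inter> eff_dom r"
    then show "(b - f x0) + (- grad f x0) \<bullet> (y - x0) - M * D y x0 \<le> rr y"
      using model_upper_boundary[OF y] b[of y] by simp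
  qed
  fix y assume y: "y \<in> eff_dom \<Phi> \<inter> eff_dom r"
  then show "\<exists>K. \<exists>\<delta>>0. \<forall>t. 0 < t \<and> t < \<delta> \<longrightarrow>
      rr (y + t *\<^sub>R (x0 - y)) + \<rho> * phi (y + t *\<^sub>R (x0 - y)) \<le> rr y + \<rho> * phi y + t * K"
    using r_rho_chord[OF y]
    by (intro exI[of _ "(rr x0 + \<rho> * phi x0) - (rr y + \<rho> * phi y)"] exI[of _ 1]) auto
qed

text \<open>
  The lower model says that \<open>f\<close> plus \<open>\<tau>\<close> times the mirror map has a subgradient at every point of
  \<open>C\<close>; together with the weak convexity of \<open>r\<close> this gives convexity of the shifted objective.
\<close>

lemma F_convex: "convex_on C (\<lambda>y. FF y + (\<rho> + \<tau>) * phi y)"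
proof -
  have "convex_on C (\<lambda>y. f y + \<tau> * phi y)"
  proof (rule convex_on_if_subgradients[OF C_convex, where s = "\<lambda>x. grad f x + \<tau> *\<^sub>R egrad \<Phi> x"])
    fix x y assume "x \<in> C" "y \<in> C"
    from model_lower[OF this]
    show "f x + \<tau> * phi x + (grad f x + \<tau> *\<^sub>R egrad \<Phi> x) \<bullet> (y - x) \<le> f y + \<tau> * phi y"
      by (simp add: inner_add_left right_diff_distrib)
  qed
  from convex_on_add[OF reg.psi_convex this] show ?thesis
    by (simp add: algebra_simps)
qed

text \<open>
  Near a boundary point, the local Lipschitz constant of \<open>f\<close> replaces the two-sided model, which
  is only available inside \<open>C\<close>.
\<close>

sublocale obj: relatively_weakly_convex \<Phi> N "objective f r" "\<rho> + \<tau>" 0 x0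
proof unfold_locales
  show "F x \<noteq> -\<infinity>" for x
    using r_not_minf[of x] by (cases "r x") (auto simp: objective_def)
  show "lsc F"
    unfolding objective_def using r_not_minf
    by (intro lsc_add lsc_continuous f_continuous reg.psi_lsc) auto
  show "convex (eff_dom F)"
    unfolding F_dom by (rule r_dom_convex)
  show "x0 \<in> U \<inter> eff_dom F"
    unfolding F_dom by (rule x0)
  show "convex_on (U \<inter> eff_dom F) (\<lambda>y. real_of_ereal (F y) + (\<rho> + \<tau>) * phi y)"
    unfolding F_dom
  proof (rule convex_onI)
    fix t x y assume "0 < t" "t < (1::real)" and xy: "x \<in> C" "y \<in> C"
    moreover from this have "(1 - t) *\<^sub>R x + t *\<^sub>R y \<in> C"
      by (intro convexD[OF C_convex]) auto
    ultimately show "real_of_ereal (F ((1 - t) *\<^sub>R x + t *\<^sub>R y)) + (\<rho> + \<tau>) * phi ((1 - t) *\<^sub>R x + t *\<^sub>R y)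
        \<le> (1 - t) * (real_of_ereal (F x) + (\<rho> + \<tau>) * phi x)
          + t * (real_of_ereal (F y) + (\<rho> + \<tau>) * phi y)"
      using convex_onD[OF F_convex, of t x y] by (simp add: F_real)
  qed (rule C_convex)
  obtain b where b: "\<And>y. y \<in> eff_dom r \<Longrightarrow> b \<le> FF y"
    using F_min_real by blast
  show "\<exists>b w. \<forall>y\<in>eff_dom \<Phi> \<inter> eff_dom F. b + w \<bullet> (y - x0) - 0 * D y x0 \<le> real_of_ereal (F y)"
    using b by (intro exI[of _ b] exI[of _ 0]) (auto simp: F_dom F_real)
  fix y assume "y \<in> eff_dom \<Phi> \<inter> eff_dom F"
  then have y: "y \<in> eff_dom \<Phi> \<inter> eff_dom r"
    by (simp add: F_dom)
  obtain u L where u: "u > 0" "L-lipschitz_on (cball y u) f"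
    using f_lipschitz unfolding locally_lipschitz_def by blast
  define R where "R = norm (x0 - y) + 1"
  have R: "R > 0" "norm (x0 - y) \<le> R"
    using norm_ge_zero[of "x0 - y"] unfolding R_def by linarith+
  define K where "K = L * R + ((rr x0 + \<rho> * phi x0) - (rr y + \<rho> * phi y)) + \<tau> * (phi x0 - phi y)"
  show "\<exists>K. \<exists>\<delta>>0. \<forall>t. 0 < t \<and> t < \<delta> \<longrightarrow>
      real_of_ereal (F (y + t *\<^sub>R (x0 - y))) + (\<rho> + \<tau>) * phi (y + t *\<^sub>R (x0 - y))
        \<le> real_of_ereal (F y) + (\<rho> + \<tau>) * phi y + t * K"
  proof (intro exI conjI allI impI)
    show "min 1 (u / R) > 0"
      using u R by simp
    fix t assume "0 < t \<and> t < min 1 (u / R)"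
    then have t: "0 < t" "t < 1" "t * R < u"
      using R by (auto simp: field_simps)
    define q where "q = y + t *\<^sub>R (x0 - y)"
    have "q \<in> C"
      unfolding q_def using y t by (intro segment_in_C) auto
    have dist: "dist q y \<le> t * R"
      using t R by (simp add: q_def dist_norm)
    then have "q \<in> cball y u"
      using t by (simp add: dist_commute)
    then have "dist (f q) (f y) \<le> L * dist q y"
      using u by (intro lipschitz_onD[OF u(2)]) auto
    also have "\<dots> \<le> L * (t * R)"
      using dist lipschitz_on_nonneg[OF u(2)] by (rule mult_left_mono)
    finally have "f q \<le> f y + L * (t * R)"
      by (simp add: dist_real_def)
    moreover have "rr q + \<rho> * phi q \<le> rr y + \<rho> * phi y + t * ((rr x0 + \<rho> * phi x0) - (rr y + \<rho> * phi y))"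
      unfolding q_def using y t by (intro r_rho_chord) auto
    moreover have "\<tau> * phi q \<le> \<tau> * phi y + t * (\<tau> * (phi x0 - phi y))"
    proof -
      have "phi q \<le> (1 - t) * phi y + t * phi x0"
        unfolding q_def using t y x0 U_subset by (intro phi_chord) auto
      then have "\<tau> * phi q \<le> \<tau> * ((1 - t) * phi y + t * phi x0)"
        using tau_nonneg by (rule mult_left_mono)
      then show ?thesis
        by (simp add: algebra_simps)
    qed
    moreover have "t * K = L * (t * R) + t * ((rr x0 + \<rho> * phi x0) - (rr y + \<rho> * phi y))
        + t * (\<tau> * (phi x0 - phi y))"
      by (simp add: K_def distrib_left)
    ultimately have "FF q + (\<rho> + \<tau>) * phi q \<le> FF y + (\<rho> + \<tau>) * phi y + t * K"
      by (simp add: distrib_right)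
    with \<open>q \<in> C\<close> y have "real_of_ereal (F q) + (\<rho> + \<tau>) * phi q
        \<le> real_of_ereal (F y) + (\<rho> + \<tau>) * phi y + t * K"
      by (simp add: F_real)
    then show "real_of_ereal (F (y + t *\<^sub>R (x0 - y))) + (\<rho> + \<tau>) * phi (y + t *\<^sub>R (x0 - y))
        \<le> real_of_ereal (F y) + (\<rho> + \<tau>) * phi y + t * K"
      by (simp only: q_def)
  qed
qed

end


section \<open>One step of mirror descent\<close>

lemma arg_min_add_const:
  fixes g :: "'a \<Rightarrow> ereal"
  shows "arg_min (\<lambda>y. ereal k + g y) P = arg_min g P"
proof -
  have "ereal k + a < ereal k + b \<longleftrightarrow> a < b" for a b :: ereal
    by (cases a; cases b) auto
  then show ?thesis
    by (simp add: arg_min_def is_arg_min_def)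
qed

context relatively_weakly_convex
begin

text \<open>
  The divergence from \<open>x\<close> is the mirror map minus a linear function, up to a constant: proximal
  steps are tilted minimisations.
\<close>

lemma bregman_step_eq_tilted:
  assumes x: "x \<in> U" and c: "c > 0"
  shows "ereal (g \<bullet> y) + \<psi> y + ereal c * bregman \<Phi> y x
    = ereal (c * (egrad \<Phi> x \<bullet> x - phi x)) + tilted \<Phi> \<psi> c (c *\<^sub>R egrad \<Phi> x - g) y"
proof -
  from x U_subset have "x \<in> eff_dom \<Phi>"
    by blast
  then obtain a where a: "\<Phi> x = ereal a"
    by (rule Phi_finite)
  show ?thesis
    using c Phi_not_minf[of y] psi_not_minf[of y]
    by (cases "\<Phi> y"; cases "\<psi> y")
      (simp_all add: a bregman_def tilted_def inner_diff_left inner_diff_right algebra_simps)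
qed

lemma arg_min_bregman_step:
  assumes "x \<in> U" "c > 0"
  shows "arg_min (\<lambda>y. ereal (g \<bullet> y) + \<psi> y + ereal c * bregman \<Phi> y x) (\<lambda>_. True)
    = tilted_argmin \<Phi> \<psi> c (c *\<^sub>R egrad \<Phi> x - g)"
  unfolding bregman_step_eq_tilted[OF assms] arg_min_add_const tilted_argmin_def by (rule refl)

lemma prox_eq_tilted_argmin:
  assumes "x \<in> U" "lam > 0"
  shows "prox \<Phi> lam \<psi> x = tilted_argmin \<Phi> \<psi> (1 / lam) ((1 / lam) *\<^sub>R egrad \<Phi> x)"
  using arg_min_bregman_step[OF assms(1), of "1 / lam" 0] assms(2)
  by (simp add: prox_def zero_ereal_def[symmetric])

context
  fixes lam :: real and x :: 'a
  assumes lam: "lam > 0" "\<mu> * lam < 1" "m * lam < 1" and x: "x \<in> U"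
begin

lemma prox_coeffs: "1 / lam > 0" "1 / lam > \<mu>" "1 / lam > m"
  using lam by (simp_all add: field_simps)

lemma prox_in_C: "prox \<Phi> lam \<psi> x \<in> C"
  unfolding prox_eq_tilted_argmin[OF x lam(1)] by (rule tilted_argmin_in_C[OF prox_coeffs])

lemma prox_minimal:
  assumes y: "y \<in> C"
  defines "p \<equiv> prox \<Phi> lam \<psi> x"
  shows "psi p + 1 / lam * D p x \<le> psi y + 1 / lam * D y x"
proof -
  have p: "p \<in> C"
    unfolding p_def by (rule prox_in_C)
  have "tilted \<Phi> \<psi> (1 / lam) ((1 / lam) *\<^sub>R egrad \<Phi> x) p
      \<le> tilted \<Phi> \<psi> (1 / lam) ((1 / lam) *\<^sub>R egrad \<Phi> x) y"
    unfolding p_def prox_eq_tilted_argmin[OF x lam(1)]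
    by (rule tilted_argmin_minimal[OF prox_coeffs(1,3)])
  then have "psi p + 1 / lam * phi p - ((1 / lam) *\<^sub>R egrad \<Phi> x) \<bullet> p
      \<le> psi y + 1 / lam * phi y - ((1 / lam) *\<^sub>R egrad \<Phi> x) \<bullet> y"
    using p y U_subset by (subst (asm) (1 2) tilted_eq) auto
  then show ?thesis
    by (simp add: right_diff_distrib inner_diff_right)
qed

lemma envelope_eq:
  defines "p \<equiv> prox \<Phi> lam \<psi> x"
  shows "envelope \<Phi> lam \<psi> x = ereal (psi p + 1 / lam * D p x)"
proof -
  have p: "p \<in> C"
    unfolding p_def by (rule prox_in_C)
  define k where "k = (1 / lam) * (egrad \<Phi> x \<bullet> x - phi x)"
  define v where "v = (1 / lam) *\<^sub>R egrad \<Phi> x"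
  have eq: "\<psi> y + ereal (1 / lam) * bregman \<Phi> y x = ereal k + tilted \<Phi> \<psi> (1 / lam) v y" for y
    using bregman_step_eq_tilted[OF x prox_coeffs(1), of 0 y]
    by (simp add: k_def v_def zero_ereal_def[symmetric])
  have p_eq: "p = tilted_argmin \<Phi> \<psi> (1 / lam) v"
    unfolding p_def v_def by (rule prox_eq_tilted_argmin[OF x lam(1)])
  have "envelope \<Phi> lam \<psi> x = \<psi> p + ereal (1 / lam) * bregman \<Phi> p x"
    unfolding envelope_def
  proof (rule antisym)
    show "(INF y. \<psi> y + ereal (1 / lam) * bregman \<Phi> y x) \<le> \<psi> p + ereal (1 / lam) * bregman \<Phi> p x"
      by (rule INF_lower) simp
    show "\<psi> p + ereal (1 / lam) * bregman \<Phi> p x \<le> (INF y. \<psi> y + ereal (1 / lam) * bregman \<Phi> y x)"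
      unfolding eq p_eq by (intro INF_greatest add_left_mono tilted_argmin_minimal prox_coeffs)
  qed
  also have "bregman \<Phi> p x = ereal (D p x)"
    using p x U_subset by (intro bregman_eq_D) auto
  also obtain a where "\<psi> p = ereal a"
    using p by (auto intro: psi_finite)
  then have "\<psi> p + ereal (1 / lam) * ereal (D p x) = ereal (psi p + 1 / lam * D p x)"
    by simp
  finally show ?thesis .
qed

end

end

context composite_problem
begin

text \<open>
  \<open>step c x g\<close> is the mirror descent update from \<open>x\<close> with inverse step size \<open>c\<close> and gradient sample
  \<open>g\<close>; \<open>env lam\<close> is the real value of the envelope.
\<close>

definition "step c x g = tilted_argmin \<Phi> r c (c *\<^sub>R egrad \<Phi> x - g)"

definition "px lam x = prox \<Phi> lam F x"

definition "env lam x = FF (px lam x) + 1 / lam * D (px lam x) x"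

context
  fixes lam :: real
  assumes lam: "lam > 0" "lam * (\<tau> + \<rho>) < 1"
begin

lemma px_coeffs: "(\<rho> + \<tau>) * lam < 1" "1 / lam > \<rho> + \<tau>"
proof -
  show "(\<rho> + \<tau>) * lam < 1"
    using lam by (simp add: algebra_simps)
  then show "1 / lam > \<rho> + \<tau>"
    using lam by (simp add: field_simps)
qed

lemma px_in_C: "x \<in> U \<Longrightarrow> px lam x \<in> C"
  using obj.prox_in_C[of lam x] lam px_coeffs(1) by (simp add: px_def F_dom)

lemma px_minimal:
  assumes "x \<in> U" "y \<in> C"
  shows "FF (px lam x) + 1 / lam * D (px lam x) x \<le> FF y + 1 / lam * D y x"
  using obj.prox_minimal[of lam x y] lam px_coeffs(1) assms px_in_C[OF assms(1)]
  by (simp add: px_def F_dom F_real)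

lemma envelope_eq_env: "x \<in> U \<Longrightarrow> envelope \<Phi> lam F x = ereal (env lam x)"
  using obj.envelope_eq[of lam x] lam px_coeffs(1) px_in_C[of x]
  by (simp add: env_def px_def F_real)

context
  fixes \<beta> c :: real
  assumes beta: "\<beta> > 0" and c_eq: "c = M + 1 / lam + \<beta>"
begin

lemma step_coeffs: "c > 0" "c > \<rho>" "c > M"
proof -
  have "1 / lam > 0"
    using lam by simp
  then show "c > M"
    using beta unfolding c_eq by linarith
  then show "c > 0"
    using M_nonneg by simp
  show "c > \<rho>"
    using px_coeffs(2) tau_nonneg M_nonneg beta by (simp add: c_eq)
qed

lemma step_in_C: "step c x g \<in> C"
  unfolding step_def by (rule reg.tilted_argmin_in_C[OF step_coeffs(1-3)])

text \<open>
  The growth inequality of the step is tested at the proximal point \<open>px lam x\<close>, the gradient is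
  replaced by the two-sided model, and the noise acting on the step length is absorbed by the
  surplus \<open>\<beta>\<close> of the inverse step size. The noise term that is linear in \<open>px lam x - x\<close> has mean
  zero, since \<open>px lam x\<close> is independent of the current sample.
\<close>

lemma one_step:
  fixes x g :: 'a
  assumes x: "x \<in> C"
  defines "h \<equiv> px lam x" and "p \<equiv> step c x g" and "e \<equiv> g - grad f x"
  shows "(c - \<rho>) * D h p \<le> (c + \<tau> - 1 / lam) * D h x + e \<bullet> (h - x) + (dual_norm N e)\<^sup>2 / (2 * \<beta>)"
proof -
  have h: "h \<in> C"
    unfolding h_def using x by (intro px_in_C) auto
  have p: "p \<in> C"
    unfolding p_def by (rule step_in_C)
  have "rr p + c * phi p - (c *\<^sub>R egrad \<Phi> x - g) \<bullet> p + (c - \<rho>) * D h p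
      \<le> rr h + c * phi h - (c *\<^sub>R egrad \<Phi> x - g) \<bullet> h"
    unfolding p_def step_def by (rule reg.tilted_argmin_growth[OF step_coeffs(1-3) h])
  then have growth: "(c - \<rho>) * D h p \<le> rr h - rr p + g \<bullet> (h - p) + c * D h x - c * D p x"
    by (simp add: inner_diff_left inner_diff_right right_diff_distrib)
  have prox: "FF h + 1 / lam * D h x \<le> FF p + 1 / lam * D p x"
    unfolding h_def using x p by (intro px_minimal) auto
  have lower: "grad f x \<bullet> (h - x) \<le> f h - f x + \<tau> * D h x"
    using model_lower[OF x h] by simp
  have upper: "grad f x \<bullet> (x - p) \<le> f x - f p + M * D p x"
    using model_upper[OF x p] by (simp add: inner_diff_right)
  have noise: "e \<bullet> (x - p) \<le> (dual_norm N e)\<^sup>2 / (2 * \<beta>) + \<beta> * D p x"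
  proof -
    define a b where "a = dual_norm N e" and "b = N (x - p)"
    have "0 \<le> (a - \<beta> * b)\<^sup>2 / (2 * \<beta>)"
      using beta by simp
    also have "\<dots> = a\<^sup>2 / (2 * \<beta>) + \<beta> / 2 * b\<^sup>2 - a * b"
      using beta by (simp add: power2_eq_square field_simps)
    finally have "a * b \<le> a\<^sup>2 / (2 * \<beta>) + \<beta> / 2 * b\<^sup>2"
      by simp
    moreover have "e \<bullet> (x - p) \<le> a * b"
      unfolding a_def b_def by (rule inner_le_dual_norm[OF N_norm])
    moreover have "1 / 2 * b\<^sup>2 \<le> D p x"
      using D_ge[of x p] x p U_subset by (auto simp: b_def is_norm_minus_commute[OF N_norm, of x])
    then have "\<beta> * (1 / 2 * b\<^sup>2) \<le> \<beta> * D p x"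
      using beta by (intro mult_left_mono) auto
    ultimately show ?thesis
      by (simp add: a_def)
  qed
  have "g \<bullet> (h - p) = grad f x \<bullet> (h - x) + grad f x \<bullet> (x - p) + e \<bullet> (h - x) + e \<bullet> (x - p)"
    by (simp add: e_def inner_diff_left inner_diff_right)
  moreover have "c * D p x = M * D p x + 1 / lam * D p x + \<beta> * D p x"
    by (simp only: c_eq distrib_right)
  moreover have "(c + \<tau> - 1 / lam) * D h x = c * D h x + \<tau> * D h x - 1 / lam * D h x"
    by (simp only: left_diff_distrib distrib_right)
  ultimately show ?thesis
    using growth prox lower upper noise by linarith
qed

text \<open>
  The proximal point at \<open>x\<close> is a competitor for the envelope at the next iterate, which turns the
  bound on the divergence into a decrease of the envelope.
\<close>

lemma env_step:
  fixes x g :: 'a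
  assumes x: "x \<in> C"
  defines "e \<equiv> g - grad f x"
  shows "env lam (step c x g) + (1 / lam - \<tau> - \<rho>) / (lam * (c - \<rho>)) * D (px lam x) x
    \<le> env lam x + 1 / (lam * (c - \<rho>)) * (e \<bullet> (px lam x - x) + (dual_norm N e)\<^sup>2 / (2 * \<beta>))"
proof -
  define h p where "h = px lam x" and "p = step c x g"
  have h: "h \<in> C"
    unfolding h_def using x by (intro px_in_C) auto
  have p: "p \<in> C"
    unfolding p_def by (rule step_in_C)
  define k where "k = 1 / (lam * (c - \<rho>))"
  have k: "k * (c - \<rho>) = 1 / lam" "k \<ge> 0"
    using lam step_coeffs(2) by (simp_all add: k_def)
  have "env lam p \<le> FF h + 1 / lam * D h p"
    unfolding env_def using p h by (intro px_minimal) auto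
  also have "1 / lam * D h p = k * ((c - \<rho>) * D h p)"
    by (simp only: k(1) mult.assoc[symmetric])
  also have "\<dots> \<le> k * ((c + \<tau> - 1 / lam) * D h x + e \<bullet> (h - x) + (dual_norm N e)\<^sup>2 / (2 * \<beta>))"
    using one_step[OF x, of g] k(2) unfolding h_def p_def e_def by (rule mult_left_mono)
  also have "\<dots> = k * (c - \<rho>) * D h x - k * (1 / lam - \<tau> - \<rho>) * D h x
      + k * (e \<bullet> (h - x) + (dual_norm N e)\<^sup>2 / (2 * \<beta>))"
    by (simp add: algebra_simps)
  also have "k * (c - \<rho>) * D h x = 1 / lam * D h x"
    by (simp only: k(1))
  finally have "env lam p \<le> FF h + (1 / lam * D h x - k * (1 / lam - \<tau> - \<rho>) * D h x
      + k * (e \<bullet> (h - x) + (dual_norm N e)\<^sup>2 / (2 * \<beta>)))"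
    by simp
  then have "env lam p + k * (1 / lam - \<tau> - \<rho>) * D h x
      \<le> env lam x + k * (e \<bullet> (h - x) + (dual_norm N e)\<^sup>2 / (2 * \<beta>))"
    unfolding env_def[of lam x] h_def[symmetric] by linarith
  then show ?thesis
    by (simp add: k_def h_def p_def)
qed

end

end

end


section \<open>Recursions driven by independent samples\<close>

primrec driven :: "('x \<Rightarrow> 'w \<Rightarrow> 'x) \<Rightarrow> 'x \<Rightarrow> (nat \<Rightarrow> 'w) \<Rightarrow> nat \<Rightarrow> 'x" where
  "driven S x0 s 0 = x0"
| "driven S x0 s (Suc t) = S (driven S x0 s t) (s t)"

lemma driven_cong:
  assumes "\<And>i. i < t \<Longrightarrow> s i = s' i"
  shows "driven S x0 s t = driven S x0 s' t"
  using assms by (induction t) auto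

context prob_space
begin

context
  fixes Q :: "'x measure" and S :: "'x \<Rightarrow> 'a \<Rightarrow> 'x" and x0 :: 'x
  assumes S: "case_prod S \<in> measurable (Q \<Otimes>\<^sub>M M) Q" and x0: "x0 \<in> space Q"
begin

lemma driven_measurable:
  assumes "{..<t} \<subseteq> J"
  shows "(\<lambda>s. driven S x0 s t) \<in> measurable (Pi\<^sub>M J (\<lambda>_. M)) Q"
  using assms
proof (induction t)
  case 0
  then show ?case using x0 by simp
next
  case (Suc t)
  then have "t \<in> J" "{..<t} \<subseteq> J"
    by auto
  then have "(\<lambda>s. (driven S x0 s t, s t)) \<in> measurable (Pi\<^sub>M J (\<lambda>_. M)) (Q \<Otimes>\<^sub>M M)"
    by (intro measurable_Pair Suc.IH measurable_component_singleton)
  from measurable_compose[OF this S] show ?case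
    by simp
qed

text \<open>
  The state at time \<open>t\<close> depends only on the samples before \<open>t\<close>, so the sample at time \<open>t\<close> can be
  integrated out first.
\<close>

lemma nn_integral_driven_Suc:
  assumes J: "finite J" "{..t} \<subseteq> J" and V: "V \<in> borel_measurable Q"
  shows "(\<integral>\<^sup>+ s. V (driven S x0 s (Suc t)) \<partial>Pi\<^sub>M J (\<lambda>_. M))
    = (\<integral>\<^sup>+ s. (\<integral>\<^sup>+ w. V (S (driven S x0 s t) w) \<partial>M) \<partial>Pi\<^sub>M J (\<lambda>_. M))"
proof -
  interpret product_sigma_finite "\<lambda>_::nat. M"
    by standard
  define I where "I = J - {t}"
  have I: "finite I" "t \<notin> I" "J = insert t I"
    using J by (auto simp: I_def)
  have sub: "{..<t} \<subseteq> insert t I"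
    by (rule subset_trans[OF _ J(2)[unfolded I(3)]]) auto
  have upd: "driven S x0 (s(t := w)) t = driven S x0 s t" for s w
    by (rule driven_cong) auto
  have VS: "(\<lambda>(x, w). V (S x w)) \<in> borel_measurable (Q \<Otimes>\<^sub>M M)"
    using measurable_compose[OF S V] by (simp add: case_prod_beta' comp_def)
  then have W: "(\<lambda>x. \<integral>\<^sup>+ w. V (S x w) \<partial>M) \<in> borel_measurable Q"
    by (rule borel_measurable_nn_integral)
  have "(\<integral>\<^sup>+ s. V (driven S x0 s (Suc t)) \<partial>Pi\<^sub>M J (\<lambda>_. M))
      = (\<integral>\<^sup>+ s. (\<integral>\<^sup>+ w. V (S (driven S x0 s t) w) \<partial>M) \<partial>Pi\<^sub>M I (\<lambda>_. M))"
    unfolding I(3)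
    using measurable_compose[OF driven_measurable V, of "Suc t" "insert t I"] J I
    by (subst product_nn_integral_insert[OF I(1,2)]) (simp_all add: upd lessThan_Suc_atMost)
  also have "\<dots> = (\<integral>\<^sup>+ s. (\<integral>\<^sup>+ u. (\<integral>\<^sup>+ w. V (S (driven S x0 (s(t := u)) t) w) \<partial>M) \<partial>M) \<partial>Pi\<^sub>M I (\<lambda>_. M))"
    by (simp add: upd emeasure_space_1)
  also have "\<dots> = (\<integral>\<^sup>+ s. (\<integral>\<^sup>+ w. V (S (driven S x0 s t) w) \<partial>M) \<partial>Pi\<^sub>M J (\<lambda>_. M))"
    unfolding I(3)
    using measurable_compose[OF driven_measurable W, of t "insert t I"] sub
    by (subst product_nn_integral_insert[OF I(1,2)]) simp_all
  finally show ?thesis .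
qed

text \<open>
  The mean of \<open>V\<close> at time \<open>n\<close> plus the decrease accumulated before grows by at most \<open>b\<close> per step. All
  quantities are nonnegative extended reals, so the integrals always exist.
\<close>

lemma driven_telescoping:
  fixes V d :: "'x \<Rightarrow> ennreal"
  assumes V: "V \<in> borel_measurable Q" and d: "d \<in> borel_measurable Q"
    and decrease: "\<And>x. x \<in> space Q \<Longrightarrow> (\<integral>\<^sup>+ w. V (S x w) \<partial>M) + a * d x \<le> V x + b"
  shows "a * (\<Sum>t\<le>T. \<integral>\<^sup>+ s. d (driven S x0 s t) \<partial>Pi\<^sub>M {..T} (\<lambda>_. M)) \<le> V x0 + of_nat (T + 1) * b"
proof -
  define PM where "PM = Pi\<^sub>M {..T} (\<lambda>_. M)"
  interpret PM: prob_space PM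
    unfolding PM_def by (intro prob_space_PiM prob_space_axioms)
  have meas: "(\<lambda>s. driven S x0 s t) \<in> measurable PM Q" if "t \<le> Suc T" for t
    unfolding PM_def using that by (intro driven_measurable) auto
  have "(\<integral>\<^sup>+ s. V (driven S x0 s n) \<partial>PM) + a * (\<Sum>t<n. \<integral>\<^sup>+ s. d (driven S x0 s t) \<partial>PM)
      \<le> V x0 + of_nat n * b" if "n \<le> Suc T" for n
    using that
  proof (induction n)
    case 0
    then show ?case
      by (simp add: PM.emeasure_space_1)
  next
    case (Suc n)
    have mV: "(\<lambda>s. V (driven S x0 s n)) \<in> borel_measurable PM"
      and md: "(\<lambda>s. d (driven S x0 s n)) \<in> borel_measurable PM"
      using Suc.prems meas[of n] by (auto intro: measurable_compose V d)
    have "(\<lambda>(x, w). V (S x w)) \<in> borel_measurable (Q \<Otimes>\<^sub>M M)"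
      using measurable_compose[OF S V] by (simp add: case_prod_beta' comp_def)
    then have W: "(\<lambda>x. \<integral>\<^sup>+ w. V (S x w) \<partial>M) \<in> borel_measurable Q"
      by (rule borel_measurable_nn_integral)
    then have mW: "(\<lambda>s. \<integral>\<^sup>+ w. V (S (driven S x0 s n) w) \<partial>M) \<in> borel_measurable PM"
      using Suc.prems meas[of n] by (auto intro: measurable_compose)
    have "(\<integral>\<^sup>+ s. V (driven S x0 s (Suc n)) \<partial>PM) + a * (\<integral>\<^sup>+ s. d (driven S x0 s n) \<partial>PM)
        = (\<integral>\<^sup>+ s. (\<integral>\<^sup>+ w. V (S (driven S x0 s n) w) \<partial>M) + a * d (driven S x0 s n) \<partial>PM)"
      using Suc.prems nn_integral_driven_Suc[of "{..T}" n V] mW md V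
      by (simp add: nn_integral_add nn_integral_cmult PM_def)
    also have "\<dots> \<le> (\<integral>\<^sup>+ s. V (driven S x0 s n) + b \<partial>PM)"
      using Suc.prems measurable_space[OF meas[of n]] by (intro nn_integral_mono decrease) auto
    also have "\<dots> = (\<integral>\<^sup>+ s. V (driven S x0 s n) \<partial>PM) + b"
      using mV by (simp add: nn_integral_add PM.emeasure_space_1)
    finally have step: "(\<integral>\<^sup>+ s. V (driven S x0 s (Suc n)) \<partial>PM) + a * (\<integral>\<^sup>+ s. d (driven S x0 s n) \<partial>PM)
        \<le> (\<integral>\<^sup>+ s. V (driven S x0 s n) \<partial>PM) + b" .
    have "(\<integral>\<^sup>+ s. V (driven S x0 s (Suc n)) \<partial>PM) + a * (\<Sum>t<Suc n. \<integral>\<^sup>+ s. d (driven S x0 s t) \<partial>PM)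
        = ((\<integral>\<^sup>+ s. V (driven S x0 s (Suc n)) \<partial>PM) + a * (\<integral>\<^sup>+ s. d (driven S x0 s n) \<partial>PM))
          + a * (\<Sum>t<n. \<integral>\<^sup>+ s. d (driven S x0 s t) \<partial>PM)"
      by (simp add: distrib_left add_ac del: driven.simps)
    also have "\<dots> \<le> ((\<integral>\<^sup>+ s. V (driven S x0 s n) \<partial>PM) + b) + a * (\<Sum>t<n. \<integral>\<^sup>+ s. d (driven S x0 s t) \<partial>PM)"
      by (intro add_right_mono step)
    also have "\<dots> = ((\<integral>\<^sup>+ s. V (driven S x0 s n) \<partial>PM) + a * (\<Sum>t<n. \<integral>\<^sup>+ s. d (driven S x0 s t) \<partial>PM)) + b"
      by (simp add: add_ac)
    also have "\<dots> \<le> (V x0 + of_nat n * b) + b"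
      using Suc by (intro add_right_mono Suc.IH) auto
    also have "\<dots> = V x0 + of_nat (Suc n) * b"
      by (simp add: distrib_right add_ac)
    finally show ?case .
  qed
  from this[OF order_refl] have "(\<integral>\<^sup>+ s. V (driven S x0 s (Suc T)) \<partial>PM) + a * (\<Sum>t\<le>T. \<integral>\<^sup>+ s. d (driven S x0 s t) \<partial>PM)
      \<le> V x0 + of_nat (T + 1) * b"
    by (simp only: lessThan_Suc_atMost flip: Suc_eq_plus1)
  then show ?thesis
    unfolding PM_def[symmetric] by (rule order_trans[OF add_increasing[OF zero_le order_refl]])
qed

end

text \<open>
  On the event that the index equals \<open>t\<close>, independence makes the law of the data its unrestricted law
  scaled by the probability of the event.
\<close>

lemma nn_integral_independent_index:
  fixes T :: nat
  assumes index: "\<iota> \<in> measurable M (count_space {..T})" and Z: "Z \<in> measurable M B"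
    and indep: "indep_set (sets (vimage_algebra (space M) \<iota> (count_space {..T})))
      (sets (vimage_algebra (space M) Z B))"
    and g: "\<And>t. t \<le> T \<Longrightarrow> g t \<in> borel_measurable B"
  shows "(\<lambda>\<omega>. g (\<iota> \<omega>) (Z \<omega>)) \<in> borel_measurable M"
    and "(\<integral>\<^sup>+ \<omega>. g (\<iota> \<omega>) (Z \<omega>) \<partial>M)
      = (\<Sum>t\<le>T. emeasure M {\<omega> \<in> space M. \<iota> \<omega> = t} * (\<integral>\<^sup>+ z. g t z \<partial>distr M B Z))"
proof -
  define E where "E t = {\<omega> \<in> space M. \<iota> \<omega> = t}" for t
  have E_eq: "\<iota> -` {t} \<inter> space M = E t" for t
    by (auto simp: E_def)
  have E: "E t \<in> sets M" if "t \<le> T" for t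
    using measurable_sets[OF index, of "{t}"] that by (simp add: E_eq)
  have gZ: "(\<lambda>\<omega>. g t (Z \<omega>)) \<in> borel_measurable M" if "t \<le> T" for t
    by (rule measurable_compose[OF Z g[OF that]])
  have split: "g (\<iota> \<omega>) (Z \<omega>) = (\<Sum>t\<le>T. indicator (E t) \<omega> * g t (Z \<omega>))" if "\<omega> \<in> space M" for \<omega>
  proof -
    have "\<iota> \<omega> \<le> T"
      using measurable_space[OF index that] by simp
    have "(\<Sum>t\<le>T. indicator (E t) \<omega> * g t (Z \<omega>)) = (\<Sum>t\<le>T. if t = \<iota> \<omega> then g t (Z \<omega>) else 0)"
      using that by (intro sum.cong) (auto simp: indicator_def E_def)
    also have "\<dots> = g (\<iota> \<omega>) (Z \<omega>)"
      using \<open>\<iota> \<omega> \<le> T\<close> by simp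
    finally show ?thesis ..
  qed
  have "(\<lambda>\<omega>. \<Sum>t\<le>T. indicator (E t) \<omega> * g t (Z \<omega>)) \<in> borel_measurable M"
    using E gZ by (intro borel_measurable_sum borel_measurable_times_ennreal borel_measurable_indicator) auto
  then show "(\<lambda>\<omega>. g (\<iota> \<omega>) (Z \<omega>)) \<in> borel_measurable M"
    by (subst measurable_cong[OF split])
  have law: "distr (density M (indicator (E t))) B Z = scale_measure (emeasure M (E t)) (distr M B Z)"
    if t: "t \<le> T" for t
  proof (rule measure_eqI)
    fix A assume "A \<in> sets (distr (density M (indicator (E t))) B Z)"
    then have A: "A \<in> sets B"
      by simp
    have ZA: "Z -` A \<inter> space M \<in> sets M"
      by (rule measurable_sets[OF Z A])
    have "E t \<in> sets (vimage_algebra (space M) \<iota> (count_space {..T}))"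
      unfolding E_eq[symmetric] using t by (intro in_vimage_algebra) simp
    moreover have "Z -` A \<inter> space M \<in> sets (vimage_algebra (space M) Z B)"
      using A by (rule in_vimage_algebra)
    ultimately have "prob (E t \<inter> (Z -` A \<inter> space M)) = prob (E t) * prob (Z -` A \<inter> space M)"
      using indep by (intro indep_setD) auto
    then have "emeasure M (E t \<inter> (Z -` A \<inter> space M)) = emeasure M (E t) * emeasure M (Z -` A \<inter> space M)"
      by (simp add: emeasure_eq_measure ennreal_mult)
    moreover have "emeasure (density M (indicator (E t))) (Z -` A \<inter> space M)
        = emeasure M (E t \<inter> (Z -` A \<inter> space M))"
      using E[OF t] ZA by (simp add: emeasure_density indicator_inter_arith[symmetric])
    ultimately show "emeasure (distr (density M (indicator (E t))) B Z) A
        = emeasure (scale_measure (emeasure M (E t)) (distr M B Z)) A"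
      using A Z by (simp add: emeasure_distr)
  qed simp
  have weighted: "(\<integral>\<^sup>+ \<omega>. indicator (E t) \<omega> * g t (Z \<omega>) \<partial>M) = emeasure M (E t) * (\<integral>\<^sup>+ z. g t z \<partial>distr M B Z)"
    if t: "t \<le> T" for t
  proof -
    have Z': "Z \<in> measurable (density M (indicator (E t))) B"
      using Z by simp
    have "(\<integral>\<^sup>+ \<omega>. indicator (E t) \<omega> * g t (Z \<omega>) \<partial>M)
        = (\<integral>\<^sup>+ z. g t z \<partial>distr (density M (indicator (E t))) B Z)"
      using E[OF t] gZ[OF t] g[OF t] by (simp add: nn_integral_distr[OF Z'] nn_integral_density)
    then show ?thesis
      using g[OF t] by (simp add: law[OF t] nn_integral_scale_measure)
  qed
  have "(\<integral>\<^sup>+ \<omega>. g (\<iota> \<omega>) (Z \<omega>) \<partial>M) = (\<integral>\<^sup>+ \<omega>. (\<Sum>t\<le>T. indicator (E t) \<omega> * g t (Z \<omega>)) \<partial>M)"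
    by (intro nn_integral_cong split)
  also have "\<dots> = (\<Sum>t\<le>T. \<integral>\<^sup>+ \<omega>. indicator (E t) \<omega> * g t (Z \<omega>) \<partial>M)"
    using E gZ by (intro nn_integral_sum borel_measurable_times_ennreal borel_measurable_indicator) auto
  also have "\<dots> = (\<Sum>t\<le>T. emeasure M (E t) * (\<integral>\<^sup>+ z. g t z \<partial>distr M B Z))"
    using weighted by (intro sum.cong) auto
  finally show "(\<integral>\<^sup>+ \<omega>. g (\<iota> \<omega>) (Z \<omega>) \<partial>M)
      = (\<Sum>t\<le>T. emeasure M {\<omega> \<in> space M. \<iota> \<omega> = t} * (\<integral>\<^sup>+ z. g t z \<partial>distr M B Z))"
    by (simp only: E_def)
qed

end


section \<open>Measurability and the expected decrease\<close>

context legendre_strongly_convex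
begin

lemma phi_borel: "phi \<in> borel_measurable borel"
  using lsc_borel_measurable[OF Phi_lsc] by simp

text \<open>The gradient is a pointwise limit of difference quotients, which are Borel.\<close>

lemma egrad_borel: "egrad \<Phi> \<in> borel_measurable (restrict_space borel U)"
  unfolding borel_measurable_euclidean_space[of "egrad \<Phi>"]
proof
  fix b :: 'a
  define q where "q n x = (phi (x + (1 / real (Suc n)) *\<^sub>R b) - phi x) / (1 / real (Suc n))" for n x
  have "(\<lambda>n. 1 / real (Suc n)) \<longlonglongrightarrow> 0"
    using LIMSEQ_inverse_real_of_nat by (simp add: inverse_eq_divide)
  then have null: "filterlim (\<lambda>n. 1 / real (Suc n)) (at_right 0) sequentially"
    unfolding filterlim_at by simp
  show "(\<lambda>x. egrad \<Phi> x \<bullet> b) \<in> borel_measurable (restrict_space borel U)"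
  proof (rule borel_measurable_LIMSEQ_real)
    show "q n \<in> borel_measurable (restrict_space borel U)" for n
    proof (rule measurable_restrict_space1)
      have "(\<lambda>x. x + (1 / real (Suc n)) *\<^sub>R b) \<in> borel_measurable borel"
        by simp
      from measurable_compose[OF this phi_borel]
      have "(\<lambda>x. phi (x + (1 / real (Suc n)) *\<^sub>R b)) \<in> borel_measurable borel" .
      then show "q n \<in> borel_measurable borel"
        unfolding q_def using phi_borel by (intro borel_measurable_divide borel_measurable_diff) simp_all
    qed
    fix x assume "x \<in> space (restrict_space borel U)"
    then have "GDERIV phi x :> egrad \<Phi> x"
      by (intro phi_GDERIV) (simp add: space_restrict_space)
    from filterlim_compose[OF GDERIV_directional[OF this] null]
    show "(\<lambda>n. q n x) \<longlonglongrightarrow> egrad \<Phi> x \<bullet> b"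
      unfolding q_def .
  qed
qed

end

context composite_problem
begin

text \<open>
  The gradient is only meaningful inside the domain of the mirror map, so the iterates are viewed as
  random variables in \<open>C\<close> with the trace of the Borel sets.
\<close>

definition "state_space = restrict_space borel C"

lemma space_state_space: "space state_space = C"
  by (simp add: state_space_def space_restrict_space)

lemma state_space_id: "(\<lambda>x. x) \<in> measurable state_space borel"
  by (simp add: state_space_def measurable_restrict_space1)

lemma state_space_id_U: "(\<lambda>x. x) \<in> measurable state_space (restrict_space borel U)"
  by (intro measurable_restrict_space2 state_space_id) (auto simp: space_state_space)

lemma egrad_state_space: "egrad \<Phi> \<in> borel_measurable state_space"
  using measurable_compose[OF state_space_id_U egrad_borel] .

lemma borel_state_space: "g \<in> measurable borel L \<Longrightarrow> g \<in> measurable state_space L"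
  using measurable_compose[OF state_space_id] .

lemma rr_borel: "rr \<in> borel_measurable borel"
  using lsc_borel_measurable[OF reg.psi_lsc] by simp

context
  fixes lam :: real
  assumes lam: "lam > 0" "lam * (\<tau> + \<rho>) < 1"
begin

lemma px_measurable: "px lam \<in> borel_measurable state_space"
proof -
  have "(\<lambda>x. (1 / lam) *\<^sub>R egrad \<Phi> x) \<in> borel_measurable state_space"
    using egrad_state_space by (intro borel_measurable_scaleR) simp_all
  moreover have "tilted_argmin \<Phi> F (1 / lam) \<in> borel_measurable borel"
    using lam px_coeffs(2)[OF lam] by (intro borel_measurable_continuous_onI obj.tilted_argmin_continuous) auto
  ultimately have "(\<lambda>x. tilted_argmin \<Phi> F (1 / lam) ((1 / lam) *\<^sub>R egrad \<Phi> x)) \<in> borel_measurable state_space"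
    by (rule measurable_compose)
  moreover have "px lam x = tilted_argmin \<Phi> F (1 / lam) ((1 / lam) *\<^sub>R egrad \<Phi> x)"
    if "x \<in> space state_space" for x
    unfolding px_def using that lam by (intro obj.prox_eq_tilted_argmin) (auto simp: space_state_space)
  ultimately show ?thesis
    by (simp cong: measurable_cong)
qed

lemma D_px_measurable: "(\<lambda>x. D (px lam x) x) \<in> borel_measurable state_space"
proof -
  have "(\<lambda>x. phi (px lam x)) \<in> borel_measurable state_space"
    by (rule measurable_compose[OF px_measurable phi_borel])
  moreover have "(\<lambda>x. px lam x - x) \<in> borel_measurable state_space"
    by (intro borel_measurable_diff px_measurable state_space_id)
  moreover note borel_state_space[OF phi_borel] egrad_state_space px_measurable state_space_id
  ultimately show ?thesis
    by (intro borel_measurable_diff borel_measurable_inner)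
qed

lemma env_measurable: "env lam \<in> borel_measurable state_space"
proof -
  have "f \<in> borel_measurable borel"
    by (rule borel_measurable_continuous_onI[OF f_continuous])
  then have "(\<lambda>x. f (px lam x)) \<in> borel_measurable state_space"
    by (rule measurable_compose[OF px_measurable])
  moreover have "(\<lambda>x. rr (px lam x)) \<in> borel_measurable state_space"
    by (rule measurable_compose[OF px_measurable rr_borel])
  ultimately show ?thesis
    unfolding env_def
    by (intro borel_measurable_add borel_measurable_times D_px_measurable) simp_all
qed

context
  fixes \<beta> c :: real
  assumes beta: "\<beta> > 0" and c_eq: "c = M + 1 / lam + \<beta>"
begin

text \<open>The step is a continuous function of the tilt, and the tilt depends measurably on state and sample.\<close>

lemma step_measurable:
  assumes G: "case_prod G \<in> borel_measurable (restrict_space borel U \<Otimes>\<^sub>M P)"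
  shows "(\<lambda>(x, w). step c x (G x w)) \<in> measurable (state_space \<Otimes>\<^sub>M P) state_space"
proof -
  have "(\<lambda>z. (fst z, snd z)) \<in> measurable (state_space \<Otimes>\<^sub>M P) (restrict_space borel U \<Otimes>\<^sub>M P)"
    by (intro measurable_Pair measurable_compose[OF measurable_fst state_space_id_U] measurable_snd)
  from measurable_compose[OF this G]
  have G': "(\<lambda>z. G (fst z) (snd z)) \<in> borel_measurable (state_space \<Otimes>\<^sub>M P)"
    by (simp add: case_prod_beta')
  have "(\<lambda>z. egrad \<Phi> (fst z)) \<in> borel_measurable (state_space \<Otimes>\<^sub>M P)"
    by (rule measurable_compose[OF measurable_fst egrad_state_space])
  with G' have "(\<lambda>z. c *\<^sub>R egrad \<Phi> (fst z) - G (fst z) (snd z)) \<in> borel_measurable (state_space \<Otimes>\<^sub>M P)"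
    by (intro borel_measurable_diff borel_measurable_scaleR) simp_all
  moreover have "tilted_argmin \<Phi> r c \<in> borel_measurable borel"
    by (intro borel_measurable_continuous_onI reg.tilted_argmin_continuous step_coeffs[OF lam beta c_eq])
  ultimately have "(\<lambda>z. step c (fst z) (G (fst z) (snd z))) \<in> borel_measurable (state_space \<Otimes>\<^sub>M P)"
    unfolding step_def by (rule measurable_compose)
  then show ?thesis
    unfolding state_space_def case_prod_beta'
    by (intro measurable_restrict_space2) (auto intro!: step_in_C[OF lam beta c_eq, THEN IntD1] step_in_C[OF lam beta c_eq, THEN IntD2])
qed

text \<open>
  The linear noise term vanishes in expectation, the quadratic one is bounded by the variance
  assumption.
\<close>

lemma expected_env_step:
  fixes \<gamma> :: "'w \<Rightarrow> 'a"
  assumes P: "prob_space P" and x: "x \<in> C"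
    and mean: "has_bochner_integral P \<gamma> (grad f x)"
    and var: "(\<integral>\<^sup>+ w. ennreal ((dual_norm N (\<gamma> w - grad f x))\<^sup>2) \<partial>P) \<le> ennreal (\<sigma>\<^sup>2 / 2)"
    and b: "\<And>y. y \<in> C \<Longrightarrow> b \<le> env lam y"
  shows "(\<integral>\<^sup>+ w. ennreal (env lam (step c x (\<gamma> w)) - b) \<partial>P)
      + ennreal ((1 / lam - \<tau> - \<rho>) / (lam * (c - \<rho>))) * ennreal (D (px lam x) x)
    \<le> ennreal (env lam x - b) + ennreal (1 / (lam * (c - \<rho>)) * (\<sigma>\<^sup>2 / (4 * \<beta>)))"
proof -
  interpret P: prob_space P
    by (rule P)
  define k a z where "k = 1 / (lam * (c - \<rho>))" and "a = (1 / lam - \<tau> - \<rho>) / (lam * (c - \<rho>))"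
    and "z = px lam x - x"
  have k: "k \<ge> 0" and a: "a \<ge> 0"
    using lam step_coeffs(2)[OF lam beta c_eq] px_coeffs(2)[OF lam] by (simp_all add: k_def a_def)
  define e where "e w = \<gamma> w - grad f x" for w
  define s where "s w = (dual_norm N (e w))\<^sup>2" for w
  have int: "integrable P \<gamma>" "(\<integral>w. \<gamma> w \<partial>P) = grad f x"
    using mean by (simp_all add: has_bochner_integral_iff)
  have e: "integrable P e" "(\<integral>w. e w \<partial>P) = 0"
    using int by (simp_all add: e_def[abs_def] P.prob_space)
  then have lin: "integrable P (\<lambda>w. e w \<bullet> z)" "(\<integral>w. e w \<bullet> z \<partial>P) = 0"
    by simp_all
  have s_le: "(\<integral>\<^sup>+ w. ennreal (s w) \<partial>P) \<le> ennreal (\<sigma>\<^sup>2 / 2)"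
    using var by (simp add: s_def e_def)
  have "dual_norm N \<in> borel_measurable borel"
    by (rule borel_measurable_continuous_onI[OF dual_norm_continuous[OF N_norm]])
  from measurable_compose[OF borel_measurable_integrable[OF e(1)] this]
  have "s \<in> borel_measurable P"
    unfolding s_def[abs_def] by (rule borel_measurable_power)
  moreover have s0: "s w \<ge> 0" for w
    by (simp add: s_def)
  moreover have "(\<integral>\<^sup>+ w. ennreal (s w) \<partial>P) < \<infinity>"
    using s_le by (rule le_less_trans) simp
  ultimately have s: "integrable P s"
    by (intro integrableI_nonneg) simp_all
  have "ennreal (\<integral>w. s w \<partial>P) \<le> ennreal (\<sigma>\<^sup>2 / 2)"
    using s_le nn_integral_eq_integral[OF s] s0 by simp
  moreover have "0 \<le> \<sigma>\<^sup>2 / 2"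
    by simp
  ultimately have s_bound: "(\<integral>w. s w \<partial>P) \<le> \<sigma>\<^sup>2 / 2"
    by (simp only: ennreal_le_iff)
  define R where "R w = (env lam x - b - a * D (px lam x) x) + k * (e w \<bullet> z + s w / (2 * \<beta>))" for w
  have V: "0 \<le> env lam (step c x (\<gamma> w)) - b" for w
    using b[OF step_in_C[OF lam beta c_eq]] by simp
  have R: "env lam (step c x (\<gamma> w)) - b \<le> R w" for w
    using env_step[OF lam beta c_eq x, of "\<gamma> w"]
    by (simp add: R_def k_def a_def z_def e_def s_def)
  have R_int: "integrable P R"
    unfolding R_def using lin(1) s by simp
  have "(\<integral>w. R w \<partial>P) = (env lam x - b - a * D (px lam x) x) + k * ((\<integral>w. s w \<partial>P) / (2 * \<beta>))"
    unfolding R_def using lin s by (simp add: P.prob_space)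
  also have "\<dots> \<le> (env lam x - b - a * D (px lam x) x) + k * ((\<sigma>\<^sup>2 / 2) / (2 * \<beta>))"
    using s_bound k beta by (intro add_left_mono mult_left_mono divide_right_mono) simp_all
  finally have R_bound: "(\<integral>w. R w \<partial>P) + a * D (px lam x) x \<le> env lam x - b + k * (\<sigma>\<^sup>2 / (4 * \<beta>))"
    by simp
  have R0: "0 \<le> R w" for w
    using V[of w] R[of w] by linarith
  have "D (px lam x) x \<ge> 0"
    using x px_in_C[OF lam, of x] U_subset by (intro D_nonneg) auto
  then have aD: "0 \<le> a * D (px lam x) x"
    using a by simp
  have "(\<integral>\<^sup>+ w. ennreal (env lam (step c x (\<gamma> w)) - b) \<partial>P) \<le> (\<integral>\<^sup>+ w. ennreal (R w) \<partial>P)"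
    by (intro nn_integral_mono ennreal_leI R)
  also have "\<dots> = ennreal (\<integral>w. R w \<partial>P)"
    using R0 by (intro nn_integral_eq_integral R_int) auto
  finally have "(\<integral>\<^sup>+ w. ennreal (env lam (step c x (\<gamma> w)) - b) \<partial>P) + ennreal a * ennreal (D (px lam x) x)
      \<le> ennreal (\<integral>w. R w \<partial>P) + ennreal (a * D (px lam x) x)"
    using a by (simp add: ennreal_mult' add_right_mono)
  also have "\<dots> = ennreal ((\<integral>w. R w \<partial>P) + a * D (px lam x) x)"
    using R0 aD by (simp add: Bochner_Integration.integral_nonneg)
  also have "\<dots> \<le> ennreal (env lam x - b + k * (\<sigma>\<^sup>2 / (4 * \<beta>)))"
    by (rule ennreal_leI[OF R_bound])
  also have "\<dots> = ennreal (env lam x - b) + ennreal (k * (\<sigma>\<^sup>2 / (4 * \<beta>)))"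
    using b[OF x] k beta by (intro ennreal_plus) auto
  finally show ?thesis
    by (simp only: k_def a_def)
qed

end

end

end


section \<open>The convergence rate\<close>

context composite_problem
begin

context
  fixes lam \<beta> c :: real and P :: "'w measure" and G :: "'a \<Rightarrow> 'w \<Rightarrow> 'a"
  assumes lam: "lam > 0" "lam * (\<tau> + \<rho>) < 1"
    and beta: "\<beta> > 0" and c_eq: "c = M + 1 / lam + \<beta>"
begin

lemma smd_eq_driven:
  assumes "\<And>i. i < t \<Longrightarrow> 1 / \<eta> i = c"
  shows "smd \<Phi> r G \<eta> x0 s t = driven (\<lambda>x w. step c x (G x w)) x0 s t
    \<and> driven (\<lambda>x w. step c x (G x w)) x0 s t \<in> C"
  using assms
proof (induction t)
  case 0
  then show ?case using x0 by simp
next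
  case (Suc t)
  define x where "x = driven (\<lambda>x w. step c x (G x w)) x0 s t"
  have x: "smd \<Phi> r G \<eta> x0 s t = x" "x \<in> C"
    using Suc by (simp_all add: x_def)
  have "smd \<Phi> r G \<eta> x0 s (Suc t) = step c x (G x (s t))"
    unfolding step_def using x Suc.prems[of t] step_coeffs(1)[OF lam beta c_eq]
    by (simp add: reg.arg_min_bregman_step)
  then show ?case
    using step_in_C[OF lam beta c_eq] by (simp add: x_def)
qed

text \<open>The envelope above a lower bound of the objective is the Lyapunov function.\<close>

lemma expected_total_divergence:
  assumes P: "prob_space P"
    and G: "case_prod G \<in> borel_measurable (restrict_space borel U \<Otimes>\<^sub>M P)"
    and mean: "\<And>x. x \<in> C \<Longrightarrow> has_bochner_integral P (G x) (grad f x)"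
    and var: "\<And>x. x \<in> C \<Longrightarrow>
      (\<integral>\<^sup>+ w. ennreal ((dual_norm N (G x w - grad f x))\<^sup>2) \<partial>P) \<le> ennreal (\<sigma>\<^sup>2 / 2)"
    and b: "\<And>y. y \<in> eff_dom r \<Longrightarrow> b \<le> FF y"
  shows "ennreal ((1 / lam - \<tau> - \<rho>) / (lam * (c - \<rho>))) * (\<Sum>t\<le>T. \<integral>\<^sup>+ s.
      ennreal (D (px lam (driven (\<lambda>x w. step c x (G x w)) x0 s t)) (driven (\<lambda>x w. step c x (G x w)) x0 s t))
        \<partial>Pi\<^sub>M {..T} (\<lambda>_. P))
    \<le> ennreal (env lam x0 - b) + of_nat (T + 1) * ennreal (1 / (lam * (c - \<rho>)) * (\<sigma>\<^sup>2 / (4 * \<beta>)))"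
proof (rule prob_space.driven_telescoping[OF P step_measurable[OF lam beta c_eq G]])
  show "x0 \<in> space state_space"
    using x0 by (simp add: space_state_space)
  show "(\<lambda>x. ennreal (env lam x - b)) \<in> borel_measurable state_space"
    using env_measurable[OF lam] by measurable
  show "(\<lambda>x. ennreal (D (px lam x) x)) \<in> borel_measurable state_space"
    using D_px_measurable[OF lam] by (rule measurable_compose) measurable
  have b': "b \<le> env lam y" if "y \<in> C" for y
  proof -
    have "px lam y \<in> C"
      using that by (intro px_in_C[OF lam]) auto
    moreover from this have "0 \<le> D (px lam y) y"
      using that U_subset by (intro D_nonneg) auto
    then have "0 \<le> 1 / lam * D (px lam y) y"
      using lam(1) by (intro mult_nonneg_nonneg) simp_all
    ultimately have "b \<le> FF (px lam y)" "0 \<le> 1 / lam * D (px lam y) y"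
      using b by auto
    then show ?thesis
      unfolding env_def by linarith
  qed
  fix x assume "x \<in> space state_space"
  then have "x \<in> C"
    by (simp add: space_state_space)
  then show "(\<integral>\<^sup>+ w. ennreal (env lam (step c x (G x w)) - b) \<partial>P)
      + ennreal ((1 / lam - \<tau> - \<rho>) / (lam * (c - \<rho>))) * ennreal (D (px lam x) x)
    \<le> ennreal (env lam x - b) + ennreal (1 / (lam * (c - \<rho>)) * (\<sigma>\<^sup>2 / (4 * \<beta>)))"
    by (intro expected_env_step[OF lam beta c_eq P] mean var b')
qed

end

end

text \<open>
  With the chosen step sizes, \<open>c - \<rho>\<close> is \<open>n\<close> times the factor \<open>K\<close> of the rate, and the second
  summand of \<open>K\<close> alone dominates the variance term.
\<close>

lemma rate_arithmetic:
  fixes n :: real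
  assumes lam: "lam > 0" and small: "(\<tau> + \<rho>) * lam < 1" and nonneg: "\<tau> \<ge> 0" "M \<ge> 0" "\<alpha> > 0" "n > 0"
    and beta: "\<beta> = sqrt n / \<alpha>" and c: "c = M + 1 / lam + \<beta>"
    and total: "(1 / lam - \<tau> - \<rho>) / (lam * (c - \<rho>)) * s
      \<le> \<Delta> + n * (1 / (lam * (c - \<rho>)) * (\<sigma>\<^sup>2 / (4 * \<beta>)))"
  shows "s / n \<le> (lam\<^sup>2 * \<Delta> + lam * (\<sigma> * \<alpha> / 2)\<^sup>2) / (1 - (\<tau> + \<rho>) * lam)
      * ((M + 1 / lam - \<rho>) / n + 1 / (\<alpha> * sqrt n))"
proof -
  define q w where "q = 1 - (\<tau> + \<rho>) * lam" and "w = lam * (c - \<rho>)"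
  define K where "K = (M + 1 / lam - \<rho>) / n + 1 / (\<alpha> * sqrt n)"
  have q: "q > 0"
    using small by (simp add: q_def)
  have sq: "sqrt n > 0" "sqrt n * sqrt n = n"
    using nonneg by simp_all
  have beta_pos: "\<beta> > 0"
    using sq nonneg by (simp add: beta)
  have "\<tau> + \<rho> < 1 / lam"
    using small lam by (simp add: field_simps)
  then have gap: "M + 1 / lam - \<rho> > 0"
    using nonneg by linarith
  have "n * (1 / (\<alpha> * sqrt n)) = \<beta>"
    using sq nonneg by (simp add: beta field_simps)
  then have nK: "c - \<rho> = n * K"
    using nonneg by (simp add: K_def c distrib_left)
  have w: "w = lam * (n * K)"
    by (simp add: w_def nK)
  have w_pos: "w > 0"
    using gap beta_pos lam by (simp add: w_def c)
  have "(1 / lam - \<tau> - \<rho>) = q / lam"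
    using lam by (simp add: q_def field_simps)
  with total have "q / (lam * w) * s \<le> \<Delta> + n * (\<sigma>\<^sup>2 / (4 * \<beta> * w))"
    unfolding w_def[symmetric] by (simp add: mult_ac)
  then have "lam * w * (q / (lam * w) * s) \<le> lam * w * (\<Delta> + n * (\<sigma>\<^sup>2 / (4 * \<beta> * w)))"
    using lam w_pos by (intro mult_left_mono) auto
  also have "lam * w * (q / (lam * w) * s) = q * s"
    using lam w_pos by simp
  also have "lam * w * (\<Delta> + n * (\<sigma>\<^sup>2 / (4 * \<beta> * w))) = lam * w * \<Delta> + lam * n * (\<sigma>\<^sup>2 / (4 * \<beta>))"
    using w_pos beta_pos by (simp add: field_simps)
  also have "\<sigma>\<^sup>2 / (4 * \<beta>) = (\<sigma> * \<alpha> / 2)\<^sup>2 * (1 / (\<alpha> * sqrt n))"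
    using sq nonneg by (simp add: beta power2_eq_square field_simps)
  also have "lam * w * \<Delta> + lam * n * ((\<sigma> * \<alpha> / 2)\<^sup>2 * (1 / (\<alpha> * sqrt n)))
      \<le> lam * w * \<Delta> + lam * n * ((\<sigma> * \<alpha> / 2)\<^sup>2 * K)"
    using gap nonneg lam by (intro add_left_mono mult_left_mono) (simp_all add: K_def)
  also have "\<dots> = (lam\<^sup>2 * \<Delta> + lam * (\<sigma> * \<alpha> / 2)\<^sup>2) * K * n"
    by (simp add: w power2_eq_square algebra_simps)
  finally have "q * s \<le> (lam\<^sup>2 * \<Delta> + lam * (\<sigma> * \<alpha> / 2)\<^sup>2) * K * n" .
  then have "s / n \<le> (lam\<^sup>2 * \<Delta> + lam * (\<sigma> * \<alpha> / 2)\<^sup>2) * K / q"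
    using q nonneg by (simp add: field_simps)
  then show ?thesis
    by (simp add: q_def K_def)
qed

theorem corollary6p3:
  fixes \<Phi> r :: "'a::euclidean_space \<Rightarrow> ereal"
    and f :: "'a \<Rightarrow> real"
    and P :: "'w measure"
    and G :: "'a \<Rightarrow> 'w \<Rightarrow> 'a"
    and \<tau> M \<rho> \<sigma> lam \<alpha> :: real
    and N :: "'a \<Rightarrow> real"
    and x0 :: 'a
    and T :: nat
    and \<eta> :: "nat \<Rightarrow> real"
    and Pr :: "'o measure"
    and \<xi> :: "nat \<Rightarrow> 'o \<Rightarrow> 'w"
    and tstar :: "'o \<Rightarrow> nat"
    and U :: "'a set"
    and F :: "'a \<Rightarrow> ereal"
    and X :: "nat \<Rightarrow> 'o \<Rightarrow> 'a"
  assumes U_eq: "U = interior (eff_dom \<Phi>)"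
    and F_eq: "F = objective f r"
    and X_eq: "\<And>t \<omega>. X t \<omega> = smd \<Phi> r G \<eta> x0 (\<lambda>i. \<xi> i \<omega>) t"
    and legendre: "legendre \<Phi>"
    and f_lipschitz: "locally_lipschitz f"
    and f_diff: "\<And>x. x \<in> U \<inter> eff_dom r \<Longrightarrow> f differentiable (at x)"
    and r_not_minf: "\<And>x. r x \<noteq> -\<infinity>"
    and r_closed: "closed_fun r"
    and r_dom_convex: "convex (eff_dom r)"
    and r_dom_ri: "rel_interior (eff_dom r) \<subseteq> U"
    and r_subdiff: "\<And>x. x \<notin> U \<Longrightarrow> limiting_subdiff (\<lambda>y. r y + \<Phi> y) x = {}"
    and P_prob: "prob_space P"
    and B2_meas: "case_prod G \<in> borel_measurable (restrict_space borel U \<Otimes>\<^sub>M P)"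
    and B2: "\<And>x. x \<in> U \<inter> eff_dom r \<Longrightarrow> has_bochner_integral P (G x) (grad f x)"
    and \<tau>_nonneg: "\<tau> \<ge> 0" and M_nonneg: "M \<ge> 0"
    and B3: "\<And>x y. x \<in> U \<inter> eff_dom r \<Longrightarrow> y \<in> U \<inter> eff_dom r \<Longrightarrow>
        ereal (- \<tau>) * bregman \<Phi> y x \<le> ereal (f y - f x - grad f x \<bullet> (y - x)) \<and>
        ereal (f y - f x - grad f x \<bullet> (y - x)) \<le> ereal M * bregman \<Phi> y x"
    and \<rho>_nonneg: "\<rho> \<ge> 0"
    and B4: "weakly_convex_rel \<rho> \<Phi> r"
    and N_norm: "is_norm N"
    and B5: "strongly_convex_fun 1 N \<Phi>"
    and B6: "\<And>x. x \<in> U \<inter> eff_dom r \<Longrightarrow>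
        (\<integral>\<^sup>+ w. ennreal ((dual_norm N (G x w - grad f x))\<^sup>2) \<partial>P) \<le> ennreal (\<sigma>\<^sup>2 / 2)"
    and F_attains_min: "\<exists>z. \<forall>x. F z \<le> F x"
    and x0: "x0 \<in> U \<inter> eff_dom r"
    and lam_pos: "lam > 0" and lam_small: "lam * (\<tau> + \<rho>) < 1"
    and \<alpha>_pos: "\<alpha> > 0"
    and \<eta>_eq: "\<And>t. t \<le> T \<Longrightarrow> \<eta> t = 1 / (M + 1 / lam + (1 / \<alpha>) * sqrt (real T + 1))"
    and Pr_prob: "prob_space Pr"
    and \<xi>_indep: "prob_space.indep_vars Pr (\<lambda>_. P) \<xi> {..T}"
    and \<xi>_distr: "\<And>t. t \<le> T \<Longrightarrow> distr Pr P (\<xi> t) = P"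
    and tstar_meas: "tstar \<in> measurable Pr (count_space {..T})"
    and tstar_distr: "\<And>t. t \<le> T \<Longrightarrow>
        measure Pr {\<omega> \<in> space Pr. tstar \<omega> = t} =
          (\<eta> t / (1 - \<eta> t * \<rho>)) / (\<Sum>s\<le>T. \<eta> s / (1 - \<eta> s * \<rho>))"
    and tstar_indep: "prob_space.indep_set Pr
        (sets (vimage_algebra (space Pr) tstar (count_space {..T})))
        (sets (vimage_algebra (space Pr) (\<lambda>\<omega>. \<lambda>i\<in>{..T}. \<xi> i \<omega>) (Pi\<^sub>M {..T} (\<lambda>_. P))))"
  shows "(\<lambda>\<omega>. bregman \<Phi> (prox \<Phi> lam F (X (tstar \<omega>) \<omega>)) (X (tstar \<omega>) \<omega>))
           \<in> borel_measurable Pr \<and>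
         enn2ereal
           (\<integral>\<^sup>+ \<omega>. e2ennreal (bregman \<Phi> (prox \<Phi> lam F (X (tstar \<omega>) \<omega>)) (X (tstar \<omega>) \<omega>)) \<partial>Pr)
         \<le> (ereal (lam\<^sup>2) * (envelope \<Phi> lam F x0 - (INF x. F x)) + ereal (lam * (\<sigma> * \<alpha> / 2)\<^sup>2))
             / ereal (1 - (\<tau> + \<rho>) * lam)
           * ereal ((M + 1 / lam - \<rho>) / (real T + 1) + 1 / (\<alpha> * sqrt (real T + 1)))"
proof -
  interpret Pr: prob_space Pr
    by (rule Pr_prob)
  interpret P: prob_space P
    by (rule P_prob)
  interpret composite_problem \<Phi> N f r \<tau> M \<rho> x0
    using legendre N_norm B5 f_lipschitz r_not_minf r_closed r_dom_convex \<tau>_nonneg M_nonneg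
      B3 B4 F_attains_min x0 unfolding U_eq F_eq by unfold_locales blast+
  have lam: "lam > 0" "lam * (\<tau> + \<rho>) < 1"
    by (rule lam_pos lam_small)+
  define n where "n = real T + 1"
  have n: "n > 0"
    by (simp add: n_def)
  define \<beta> c where "\<beta> = sqrt n / \<alpha>" and "c = M + 1 / lam + \<beta>"
  have beta: "\<beta> > 0"
    using n \<alpha>_pos by (simp add: \<beta>_def)
  have \<eta>: "\<eta> t = 1 / c" if "t \<le> T" for t
    using \<eta>_eq[OF that] by (simp add: c_def \<beta>_def n_def)
  note ctx = lam beta c_def

  define S where "S = (\<lambda>x w. step c x (G x w))"
  define d where "d x = D (px lam x) x" for x
  define \<Xi> where "\<Xi> = (\<lambda>\<omega>. \<lambda>i\<in>{..T}. \<xi> i \<omega>)"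
  define B where "B = Pi\<^sub>M {..T} (\<lambda>_. P)"
  define g where "g t s = ennreal (d (driven S x0 s t))" for t s
  have S: "case_prod S \<in> measurable (state_space \<Otimes>\<^sub>M P) state_space"
    unfolding S_def using step_measurable[OF ctx B2_meas[unfolded U_eq]] .

  \<comment> \<open>Iterates up to time \<open>T\<close> only read samples collected in \<open>\<Xi>\<close>.\<close>
  have state: "X t \<omega> = driven S x0 (\<Xi> \<omega>) t \<and> X t \<omega> \<in> C" if "t \<le> T" for t \<omega>
  proof -
    have "1 / \<eta> i = c" if "i < t" for i
      using \<eta>[of i] that \<open>t \<le> T\<close> by simp
    from smd_eq_driven[OF ctx this, where G = G and s = "\<lambda>i. \<xi> i \<omega>"]
    have "X t \<omega> = driven S x0 (\<lambda>i. \<xi> i \<omega>) t" "X t \<omega> \<in> C"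
      unfolding X_eq S_def by simp_all
    moreover have "driven S x0 (\<lambda>i. \<xi> i \<omega>) t = driven S x0 (\<Xi> \<omega>) t"
      using that by (intro driven_cong) (simp add: \<Xi>_def)
    ultimately show ?thesis
      by simp
  qed
  have d_nonneg: "bregman \<Phi> (prox \<Phi> lam F x) x = ereal (d x) \<and> 0 \<le> d x" if "x \<in> C" for x
  proof -
    have "px lam x \<in> interior (eff_dom \<Phi>)"
      using that px_in_C[OF lam, of x] by auto
    then show ?thesis
      using that U_subset D_nonneg[of x "px lam x"] bregman_eq_D[of x "px lam x"]
      unfolding F_eq d_def px_def[symmetric] by blast
  qed
  have tstar_le: "tstar \<omega> \<le> T" if "\<omega> \<in> space Pr" for \<omega>
    using measurable_space[OF tstar_meas that] by simp
  have integrand: "bregman \<Phi> (prox \<Phi> lam F (X (tstar \<omega>) \<omega>)) (X (tstar \<omega>) \<omega>)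
      = enn2ereal (g (tstar \<omega>) (\<Xi> \<omega>))" if "\<omega> \<in> space Pr" for \<omega>
  proof -
    have x: "driven S x0 (\<Xi> \<omega>) (tstar \<omega>) = X (tstar \<omega>) \<omega>" "X (tstar \<omega>) \<omega> \<in> C"
      using state[OF tstar_le[OF that], of \<omega>] by metis+
    show ?thesis
      unfolding g_def x(1) using d_nonneg[OF x(2)] by (simp add: enn2ereal_ennreal)
  qed

  have rv: "\<xi> t \<in> measurable Pr P" if "t \<le> T" for t
    using \<xi>_indep that unfolding Pr.indep_vars_def by auto
  have \<Xi>_rv: "\<Xi> \<in> measurable Pr B"
    unfolding \<Xi>_def B_def by (intro measurable_restrict rv) simp
  have law: "distr Pr B \<Xi> = B"
  proof -
    have "distr Pr B \<Xi> = Pi\<^sub>M {..T} (\<lambda>i. distr Pr P (\<xi> i))"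
      using \<xi>_indep unfolding \<Xi>_def B_def
      by (subst (asm) Pr.indep_vars_iff_distr_eq_PiM') (auto intro: rv)
    also have "\<dots> = B"
      unfolding B_def by (intro PiM_cong \<xi>_distr) auto
    finally show ?thesis .
  qed
  have g_meas: "g t \<in> borel_measurable B" if "t \<le> T" for t
  proof -
    have "(\<lambda>s. driven S x0 s t) \<in> measurable B state_space"
      unfolding B_def using that x0
      by (intro P.driven_measurable[OF S]) (auto simp: space_state_space U_eq)
    from measurable_compose[OF this D_px_measurable[OF lam]] show ?thesis
      unfolding g_def[abs_def] d_def by (rule measurable_compose) measurable
  qed
  note index = tstar_meas \<Xi>_rv tstar_indep[folded \<Xi>_def B_def] g_meas
  have index_meas: "(\<lambda>\<omega>. g (tstar \<omega>) (\<Xi> \<omega>)) \<in> borel_measurable Pr"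
    by (rule Pr.nn_integral_independent_index(1)[OF index])
  have index_integral: "(\<integral>\<^sup>+ \<omega>. g (tstar \<omega>) (\<Xi> \<omega>) \<partial>Pr)
      = (\<Sum>t\<le>T. emeasure Pr {\<omega> \<in> space Pr. tstar \<omega> = t} * (\<integral>\<^sup>+ s. g t s \<partial>B))"
    by (rule Pr.nn_integral_independent_index(2)[OF index, unfolded law])

  \<comment> \<open>All indices have the same weight, so the returned index is uniformly distributed.\<close>
  define w where "w = (1 / c) / (1 - (1 / c) * \<rho>)"
  have "c > 0" "c > \<rho>"
    using step_coeffs[OF ctx] by simp_all
  then have "w > 0"
    by (simp add: w_def)
  have prob_tstar: "emeasure Pr {\<omega> \<in> space Pr. tstar \<omega> = t} = ennreal (1 / n)" if "t \<le> T" for t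
  proof -
    have "(\<Sum>s\<le>T. \<eta> s / (1 - \<eta> s * \<rho>)) = (\<Sum>s\<le>T. w)"
      by (intro sum.cong) (auto simp: \<eta> w_def)
    also have "\<dots> = n * w"
      by (simp add: n_def)
    finally have "measure Pr {\<omega> \<in> space Pr. tstar \<omega> = t} = w / (n * w)"
      using tstar_distr[OF that] \<eta>[OF that] by (simp add: w_def)
    then show ?thesis
      using \<open>w > 0\<close> by (simp add: Pr.emeasure_eq_measure)
  qed

  obtain z where z: "\<And>x. F z \<le> F x"
    using F_attains_min unfolding F_eq by blast
  have "F x0 < \<infinity>"
    using x0 F_dom unfolding F_eq eff_dom_def by blast
  then have "z \<in> eff_dom F"
    unfolding eff_dom_def using z[of x0] by (auto intro: le_less_trans)
  then have "z \<in> eff_dom r"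
    by (simp add: F_eq F_dom)
  then obtain m0 where "r z = ereal m0"
    by (rule r_finite)
  then obtain m where m: "F z = ereal m"
    by (simp add: F_eq objective_def)
  have INF_F: "(INF x. F x) = ereal m"
    unfolding m[symmetric] by (intro antisym INF_lower INF_greatest z) simp
  have m_le: "m \<le> FF y" if "y \<in> eff_dom r" for y
  proof -
    from that obtain a where "r y = ereal a"
      by (rule r_finite)
    with z[of y] m show ?thesis
      by (simp add: F_eq objective_def)
  qed
  have x0_U: "x0 \<in> interior (eff_dom \<Phi>)"
    using x0 by (simp add: U_eq)
  have env0: "envelope \<Phi> lam F x0 = ereal (env lam x0)"
    unfolding F_eq by (rule envelope_eq_env[OF lam x0_U])
  define \<Delta> where "\<Delta> = env lam x0 - m"
  have \<Delta>: "\<Delta> \<ge> 0"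
  proof -
    have px: "px lam x0 \<in> C"
      by (rule px_in_C[OF lam x0_U])
    then have "0 \<le> D (px lam x0) x0"
      using U_subset x0_U by (intro D_nonneg) auto
    then have "0 \<le> 1 / lam * D (px lam x0) x0"
      using lam(1) by (intro mult_nonneg_nonneg) simp_all
    moreover have "m \<le> FF (px lam x0)"
      using px by (intro m_le) simp
    ultimately show ?thesis
      unfolding \<Delta>_def env_def by linarith
  qed

  define I where "I = (\<Sum>t\<le>T. \<integral>\<^sup>+ s. g t s \<partial>B)"
  define a b where "a = (1 / lam - \<tau> - \<rho>) / (lam * (c - \<rho>))"
    and "b = 1 / (lam * (c - \<rho>)) * (\<sigma>\<^sup>2 / (4 * \<beta>))"
  have a: "a > 0"
    using lam(1) px_coeffs(2)[OF lam] \<open>c > \<rho>\<close> by (simp add: a_def)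
  have b: "b \<ge> 0"
    using lam(1) beta \<open>c > \<rho>\<close> by (simp add: b_def)
  have "ennreal a * I \<le> ennreal \<Delta> + of_nat (T + 1) * ennreal b"
    unfolding I_def g_def d_def S_def B_def a_def b_def \<Delta>_def
    by (rule expected_total_divergence[OF ctx P_prob B2_meas[unfolded U_eq] B2[unfolded U_eq]
        B6[unfolded U_eq] m_le])
  also have "\<dots> = ennreal (\<Delta> + n * b)"
  proof -
    have "of_nat (T + 1) = ennreal n"
      by (simp only: n_def ennreal_of_nat_eq_real_of_nat of_nat_add of_nat_1)
    then have "of_nat (T + 1) * ennreal b = ennreal (n * b)"
      using b n by (simp only: ennreal_mult less_imp_le)
    then show ?thesis
      using \<Delta> b n by simp
  qed
  finally have total: "ennreal a * I \<le> ennreal (\<Delta> + n * b)" .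
  then have "I \<noteq> \<top>"
    using a by (auto simp: ennreal_mult_top top_unique)
  then obtain s where s: "I = ennreal s" "s \<ge> 0"
    by (cases I) auto
  have "ennreal (a * s) \<le> ennreal (\<Delta> + n * b)"
    using total a s by (simp add: ennreal_mult)
  moreover have "0 \<le> \<Delta> + n * b"
    using \<Delta> b n by simp
  ultimately have "a * s \<le> \<Delta> + n * b"
    by (simp only: ennreal_le_iff)
  then have rate: "s / n \<le> (lam\<^sup>2 * \<Delta> + lam * (\<sigma> * \<alpha> / 2)\<^sup>2) / (1 - (\<tau> + \<rho>) * lam)
      * ((M + 1 / lam - \<rho>) / n + 1 / (\<alpha> * sqrt n))"
    using lam \<tau>_nonneg M_nonneg \<alpha>_pos n unfolding a_def b_def
    by (intro rate_arithmetic[OF _ _ _ _ _ _ \<beta>_def c_def]) (simp_all add: mult.commute)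

  have "(\<integral>\<^sup>+ \<omega>. e2ennreal (bregman \<Phi> (prox \<Phi> lam F (X (tstar \<omega>) \<omega>)) (X (tstar \<omega>) \<omega>)) \<partial>Pr)
      = (\<integral>\<^sup>+ \<omega>. g (tstar \<omega>) (\<Xi> \<omega>) \<partial>Pr)"
    by (intro nn_integral_cong) (simp add: integrand)
  also have "\<dots> = (\<Sum>t\<le>T. ennreal (1 / n) * (\<integral>\<^sup>+ s. g t s \<partial>B))"
    unfolding index_integral by (intro sum.cong) (auto simp: prob_tstar)
  also have "\<dots> = ennreal (1 / n) * I"
    by (simp add: I_def sum_distrib_left)
  also have "\<dots> = ennreal (s / n)"
    using s n by (simp add: ennreal_mult[symmetric])
  finally have "enn2ereal
      (\<integral>\<^sup>+ \<omega>. e2ennreal (bregman \<Phi> (prox \<Phi> lam F (X (tstar \<omega>) \<omega>)) (X (tstar \<omega>) \<omega>)) \<partial>Pr)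
    = ereal (s / n)"
    using s n by (simp add: enn2ereal_ennreal)
  also have "\<dots> \<le> ereal ((lam\<^sup>2 * \<Delta> + lam * (\<sigma> * \<alpha> / 2)\<^sup>2) / (1 - (\<tau> + \<rho>) * lam)
      * ((M + 1 / lam - \<rho>) / n + 1 / (\<alpha> * sqrt n)))"
    using rate by simp
  also have "\<dots> = (ereal (lam\<^sup>2) * (envelope \<Phi> lam F x0 - (INF x. F x)) + ereal (lam * (\<sigma> * \<alpha> / 2)\<^sup>2))
      / ereal (1 - (\<tau> + \<rho>) * lam)
      * ereal ((M + 1 / lam - \<rho>) / (real T + 1) + 1 / (\<alpha> * sqrt (real T + 1)))"
  proof -
    have "1 - (\<tau> + \<rho>) * lam \<noteq> 0"
      using lam(2) by (simp add: mult.commute)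
    then show ?thesis
      unfolding env0 INF_F by (simp add: \<Delta>_def n_def)
  qed
  finally show ?thesis
    using measurable_compose[OF index_meas measurable_enn2ereal]
    by (auto simp: integrand cong: measurable_cong)
qed

end
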